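(* Let $n,r,k,$ and $a$ be positive integers, where $r,k\geq 2$, $n>a$, and $n\geq rk$. Then $$\chi(\operatorname{KG}^r(n,k,a))=\left\lceil\frac{n-\max\{r(k-1),a\}}{r-1}\right\rceil,$$ provided that either $a\leq 2(k-1)$ or $a\geq rk-1$. Moreover, for $2k-1\leq a\leq rk-2$, we have $$\left\lceil\frac{n-r(k-1)-\lfloor\frac{a}{k}\rfloor}{r-1}\right\rceil\leq\chi(\operatorname{KG}^r(n,k,a))\leq\left\lceil\frac{n-\max\{r(k-1),a\}}{r-1}\right\rceil.$$
   Context: $[n]=\{1,\ldots,n\}$. $\mathcal{H}(n,k,a)$ is the hypergraph with vertex set $[n]$ whose edges are all $k$-element subsets $e$ of $[n]$ with $e\not\subseteq\{n-a+1,\ldots,n\}$. $\operatorname{KG}^r(n,k,a)$ denotes the hypergraph whose vertices are the edges of $\mathcal{H}(n,k,a)$ and whose edges are all sets $\{e_1,\ldots,e_r\}$ of $r$ pairwise disjoint edges of $\mathcal{H}(n,k,a)$. The chromatic number $\chi$ of a hypergraph is the minimum number of colors in a vertex coloring with no monochromatic edge. *)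

theory Defs
  imports Complex_Main
begin

datatype 'a hypergraph = Hypergraph (verts: "'a set") (edges: "'a set set")

definition monochromatic :: "('a \<Rightarrow> 'c) \<Rightarrow> 'a set \<Rightarrow> bool" where
  "monochromatic f e \<longleftrightarrow> (\<exists>c. \<forall>v\<in>e. f v = c)"

definition proper_coloring :: "'a hypergraph \<Rightarrow> nat \<Rightarrow> ('a \<Rightarrow> nat) \<Rightarrow> bool" where
  "proper_coloring H m f \<longleftrightarrow>
     f ` verts H \<subseteq> {..<m} \<and> (\<forall>e\<in>edges H. \<not> monochromatic f e)"

text \<open>Meaningful only for hypergraphs that have a proper coloring; this is the case when the vertex
  set is finite and every edge has at least two elements, see \<open>chromatic_number_attained\<close>.\<close>

definition chromatic_number :: "'a hypergraph \<Rightarrow> nat" where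
  "chromatic_number H = (LEAST m. \<exists>f. proper_coloring H m f)"

text \<open>The condition that the set does not lie in the last \<open>a\<close> elements of \<open>[n]\<close> is intended for
  \<open>a \<le> n\<close>, where the subtraction of naturals is exact.\<close>

definition hyp :: "nat \<Rightarrow> nat \<Rightarrow> nat \<Rightarrow> nat hypergraph" where
  "hyp n k a =
     Hypergraph {1..n} {e. e \<subseteq> {1..n} \<and> card e = k \<and> \<not> e \<subseteq> {n - a + 1..n}}"

definition kneser :: "nat \<Rightarrow> 'a hypergraph \<Rightarrow> 'a set hypergraph" where
  "kneser r H = Hypergraph (edges H) {E. E \<subseteq> edges H \<and> card E = r \<and> pairwise disjnt E}"

definition KG :: "nat \<Rightarrow> nat \<Rightarrow> nat \<Rightarrow> nat \<Rightarrow> nat set hypergraph" where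
  "KG r n k a = kneser r (hyp n k a)"

lemma chromatic_number_attained:
  assumes fin: "finite (verts H)"
    and sub: "\<And>e. e \<in> edges H \<Longrightarrow> e \<subseteq> verts H"
    and two: "\<And>e. e \<in> edges H \<Longrightarrow> 2 \<le> card e"
  shows "\<exists>f. proper_coloring H (chromatic_number H) f"
proof -
  obtain f :: "'a \<Rightarrow> nat" and m where f: "f ` verts H = {i. i < m}" "inj_on f (verts H)"
    using finite_imp_nat_seg_image_inj_on[OF finite_imageI] finite_imp_inj_to_nat_seg[OF fin]
    by metis
  have "\<not> monochromatic f e" if e: "e \<in> edges H" for e
  proof
    assume "monochromatic f e"
    then have "\<forall>x\<in>e. \<forall>y\<in>e. x = y"
      using f(2) sub[OF e] unfolding monochromatic_def inj_on_def by (metis subsetD)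
    then have "card e \<le> Suc 0"
      by (metis card_le_Suc0_iff_eq card.infinite le0)
    then show False
      using two[OF e] by simp
  qed
  then have "proper_coloring H m f"
    using f(1) unfolding proper_coloring_def by auto
  then show ?thesis
    unfolding chromatic_number_def by (rule_tac LeastI_ex) blast
qed

lemma KG_chromatic_number_attained:
  assumes "2 \<le> r"
  shows "\<exists>f. proper_coloring (KG r n k a) (chromatic_number (KG r n k a)) f"
proof (rule chromatic_number_attained)
  show "finite (verts (KG r n k a))"
    by (rule finite_subset[of _ "Pow {1..n}"]) (auto simp: KG_def kneser_def hyp_def)
qed (use assms in \<open>auto simp: KG_def kneser_def\<close>)

end

theory Submission
  imports Defs "HOL-Number_Theory.Cong" "HOL-Library.Disjoint_Sets"
begin

text \<open>Lower bounds: for a prime \<open>p\<close>, a colouring of \<open>KG\<^sup>p\<close> with few colours yields a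
  \<open>\<int>\<^sub>p\<close>-equivariant labelling of the nonzero vectors in \<open>(\<int>\<^sub>p \<union> {0})\<^sup>n\<close> that contradicts the
  \<open>\<int>\<^sub>p\<close>-Tucker lemma. The label of a vector none of whose classes contains an edge is given by its
  largest equitable subvector, that of any other vector by the colours of the edges in its classes.
  Thus \<open>n\<close> is at most \<open>(p - 1) \<chi>\<close> plus the maximal size of an edge-free equitable family of
  \<open>p\<close> disjoint sets. The bound for \<open>a b\<close> follows from those for \<open>a\<close> and \<open>b\<close>, by colouring the sets
  that contain \<open>a\<close> disjoint edges of one colour with such a colour.

  The Tucker lemma is proved by evaluating cochains: starting from the augmentation, one alternately
  divides by \<open>g - 1\<close> or \<open>1 + g + \<dots> + g\<^sup>p\<^sup>-\<^sup>1\<close> and takes the coboundary, which preserves the value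
  \<open>1\<close> (modulo \<open>p\<close>) on the corresponding chain of the sphere, until the cochain vanishes because
  there are too few levels.\<close>

subsection \<open>Cochains on lists\<close>

text \<open>The Tucker lemma holds here for every \<open>p > 1\<close>; primality is needed for the
  centre of mass. That device allows the sign of a label to be a nonempty proper set of signs
  rotating with the vector, so that a level can count pairs of class and colour, at most
  \<open>p - 1\<close> per colour. Composite \<open>r\<close> then has to go through products.
  Equitable families are measured because splitting the parts of an equitable splitting equitably is
  again equitable, so the extremal quantity survives the composition. The ranges of \<open>a\<close>
  come from the classes with at least \<open>k\<close> elements: in an edge-free vector they lie
  among the last \<open>a\<close> numbers. In an equitable family of size \<open>t\<close> either
  all classes are that large, whence \<open>t \<le> a\<close>, or at most \<open>a div k\<close>
  are, whence \<open>t \<le> r * (k - 1) + a div k\<close>. For \<open>a \<le> 2 * (k - 1)\<close>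
  the last summand is at most 1, and merging levels removes it.\<close>

text \<open>The simplicial coboundary: \<open>u\<close> over the lists with one entry deleted, with
  alternating signs. A one-entry list gets the value at the empty list, so the complex is
  augmented.\<close>

fun coboundary :: "('a list \<Rightarrow> int) \<Rightarrow> 'a list \<Rightarrow> int" where
  "coboundary u [] = 0"
| "coboundary u (x # xs) = u xs - coboundary (\<lambda>l. u (x # l)) xs"

lemma coboundary_diff: "coboundary (\<lambda>l. u l - v l) l = coboundary u l - coboundary v l"
  by (induction u l arbitrary: v rule: coboundary.induct) auto

lemma coboundary_sum:
  "coboundary (\<lambda>l. \<Sum>i\<in>I. u i l) l = (\<Sum>i\<in>I. coboundary (u i) l)"
proof (induction l arbitrary: u)
  case (Cons x xs)
  show ?case by (simp add: Cons[of "\<lambda>i l. u i (x # l)"] sum_subtractf)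
qed simp

lemma coboundary_map: "coboundary u (map f l) = coboundary (\<lambda>l. u (map f l)) l"
  by (induction l arbitrary: u) auto

lemma coboundary_coboundary [simp]: "coboundary (coboundary u) l = 0"
  by (induction l arbitrary: u) (auto simp: coboundary_diff)

lemma coboundary_cong_mod:
  assumes "\<And>l'. Suc (length l') = length l \<Longrightarrow> set l' \<subseteq> set l \<Longrightarrow> [u l' = v l'] (mod m)"
  shows "[coboundary u l = coboundary v l] (mod m)"
  using assms
proof (induction l arbitrary: u v)
  case (Cons x xs)
  have "[u xs = v xs] (mod m)"
    by (rule Cons.prems) auto
  moreover have "[coboundary (\<lambda>l. u (x # l)) xs = coboundary (\<lambda>l. v (x # l)) xs] (mod m)"
    by (rule Cons.IH, rule Cons.prems) auto
  ultimately show ?case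
    by (simp add: cong_diff)
qed simp

definition normalized :: "('a list \<Rightarrow> int) \<Rightarrow> bool" where
  "normalized u \<longleftrightarrow> (\<forall>xs a ys. u (xs @ a # a # ys) = 0)"

text \<open>Deleting either of two equal neighbours gives the same list with opposite signs; every
  other deletion keeps such a pair.\<close>

lemma normalized_coboundary:
  assumes "normalized u"
  shows "normalized (coboundary u)"
proof -
  have "coboundary u (xs @ a # a # ys) = 0" for xs a ys
    using assms
  proof (induction xs arbitrary: u)
    case Nil
    have z: "u (a # a # l) = 0" for l
      using Nil unfolding normalized_def by (metis append_Nil)
    have "coboundary (\<lambda>l. u (a # a # l)) ys = coboundary (\<lambda>l. u l - u l) ys"
      by (simp add: z)
    then show ?case
      unfolding coboundary_diff by simp
  next
    case (Cons x xs)
    have "normalized (\<lambda>l. u (x # l))"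
      using Cons.prems unfolding normalized_def by (metis append_Cons)
    from Cons.IH[OF this] show ?case
      using Cons.prems by (simp add: normalized_def)
  qed
  then show ?thesis by (simp add: normalized_def)
qed

section \<open>Prism and cone homotopies\<close>

fun prism :: "('a \<Rightarrow> 'a) \<Rightarrow> ('a list \<Rightarrow> int) \<Rightarrow> 'a list \<Rightarrow> int" where
  "prism j u [] = 0"
| "prism j u (x # xs) = u (x # j x # map j xs) - prism j (\<lambda>l. u (x # l)) xs"

lemma prism_diff: "prism j (\<lambda>l. u l - v l) l = prism j u l - prism j v l"
  by (induction l arbitrary: u v) auto

text \<open>The terms of \<open>prism\<close> follow \<open>l\<close> up to an entry
  \<open>x\<close>, step to \<open>j x\<close> and continue along \<open>map j\<close>. They fill
  the prism between \<open>l\<close> and \<open>map j l\<close>, whose ends give the right-hand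
  side.\<close>

lemma prism_coboundary:
  "prism j (coboundary w) l + coboundary (prism j w) l = w (map j l) - w l"
proof (induction l arbitrary: w)
  case (Cons x xs)
  show ?case
    using Cons[of "\<lambda>l. w (x # l)"]
    by (simp add: prism_diff coboundary_diff coboundary_map)
qed simp

lemma prism_cong_mod:
  assumes "\<And>l1 x l2. l = l1 @ x # l2 \<Longrightarrow>
     [u (l1 @ x # j x # map j l2) = v (l1 @ x # j x # map j l2)] (mod m)"
  shows "[prism j u l = prism j v l] (mod m)"
  using assms
proof (induction l arbitrary: u v)
  case (Cons x xs)
  have "[u (x # j x # map j xs) = v (x # j x # map j xs)] (mod m)"
    using Cons.prems[of "[]" x xs] by simp
  moreover have "[prism j (\<lambda>l. u (x # l)) xs = prism j (\<lambda>l. v (x # l)) xs] (mod m)"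
  proof (rule Cons.IH)
    fix l1 y l2 assume "xs = l1 @ y # l2"
    then show "[u (x # l1 @ y # j y # map j l2) = v (x # l1 @ y # j y # map j l2)] (mod m)"
      using Cons.prems[of "x # l1" y l2] by simp
  qed
  ultimately show ?case
    by (simp add: cong_diff)
qed simp

text \<open>The contraction along the zigzag from \<open>x\<close> to \<open>j x\<close> to
  \<open>b\<close>: the cone with apex \<open>b\<close> over the image under \<open>j\<close>,
  corrected by the prism. Thus \<open>b\<close> has to be comparable with \<open>j x\<close>
  only.\<close>

definition cone :: "'a \<Rightarrow> ('a \<Rightarrow> 'a) \<Rightarrow> ('a list \<Rightarrow> int) \<Rightarrow> 'a list \<Rightarrow> int" where
  "cone b j u l = u (b # map j l) - prism j u l"

lemma cone_diff: "cone b j (\<lambda>l. u l - v l) l = cone b j u l - cone b j v l"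
  by (simp add: cone_def prism_diff)

lemma cone_coboundary: "cone b j (coboundary w) l = w l - coboundary (cone b j w) l"
proof -
  have "coboundary (cone b j w) l = coboundary (\<lambda>l. w (b # map j l)) l - coboundary (prism j w) l"
    unfolding cone_def by (rule coboundary_diff)
  then show ?thesis
    using prism_coboundary[of j w l]
    by (simp add: cone_def coboundary_map)
qed

text \<open>The two boundary operators \<open>g - 1\<close> and \<open>1 + g + \<dots> + g\<^sup>p\<^sup>-\<^sup>1\<close> of the minimal free resolution
  of the cyclic group of order \<open>p\<close>, acting on cochains.\<close>

definition resol :: "nat \<Rightarrow> ('a \<Rightarrow> 'a) \<Rightarrow> nat \<Rightarrow> ('a list \<Rightarrow> int) \<Rightarrow> 'a list \<Rightarrow> int" where
  "resol p g d v l = (if even d then v (map g l) - v l else (\<Sum>i<p. v (map (g ^^ i) l)))"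

lemma resol_diff: "resol p g d (\<lambda>l. u l - v l) l = resol p g d u l - resol p g d v l"
  by (simp add: resol_def sum_subtractf)

lemma resol_coboundary: "resol p g d (coboundary v) l = coboundary (resol p g d v) l"
  unfolding resol_def
  by (cases "even d") (simp_all add: coboundary_map coboundary_diff coboundary_sum)

text \<open>In either order the composition telescopes to the difference of \<open>g ^^ p\<close>
  and the identity.\<close>

lemma resol_resol:
  assumes "g ^^ p = id"
  shows "resol p g d (resol p g (Suc d) v) l = 0"
proof -
  have "(\<Sum>i<p. v (map (g ^^ i \<circ> g) l) - v (map (g ^^ i) l)) = 0"
    using sum_lessThan_telescope[of "\<lambda>i. v (map (g ^^ i) l)" p] assms
    by (simp add: funpow_Suc_right del: funpow.simps(2))
  moreover have "(\<Sum>i<p. v (map (g \<circ> g ^^ i) l) - v (map (g ^^ i) l)) = 0"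
    using sum_lessThan_telescope[of "\<lambda>i. v (map (g ^^ i) l)" p] assms
    by simp
  ultimately show ?thesis
    by (auto simp: resol_def sum_subtractf)
qed

text \<open>Evaluation of a cochain on a \<open>d\<close>-dimensional chain \<open>h\<^sub>d\<close> with \<open>\<partial> h\<^sub>d\<^sub>+\<^sub>1 = (g - 1) h\<^sub>d\<close> for even
  \<open>d\<close> and \<open>\<partial> h\<^sub>d\<^sub>+\<^sub>1 = (1 + g + \<dots> + g\<^sup>p\<^sup>-\<^sup>1) h\<^sub>d\<close> for odd \<open>d\<close>; the next chain is obtained by
  coning off with the help of one more coordinate.\<close>

fun sphere_eval ::
    "nat \<Rightarrow> ('a \<Rightarrow> 'a) \<Rightarrow> (nat \<Rightarrow> 'a) \<Rightarrow> (nat \<Rightarrow> 'a \<Rightarrow> 'a) \<Rightarrow> nat \<Rightarrow> ('a list \<Rightarrow> int) \<Rightarrow> int" where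
  "sphere_eval p g b j 0 u = u [b 0]"
| "sphere_eval p g b j (Suc d) u =
     sphere_eval p g b j d (resol p g d (cone (b (Suc d)) (j (Suc d)) u))"

lemma sphere_eval_diff:
  "sphere_eval p g b j d (\<lambda>l. u l - v l) = sphere_eval p g b j d u - sphere_eval p g b j d v"
proof (induction d arbitrary: u v)
  case (Suc d)
  have "resol p g d (cone (b (Suc d)) (j (Suc d)) (\<lambda>l. u l - v l)) =
      (\<lambda>l. resol p g d (cone (b (Suc d)) (j (Suc d)) u) l -
           resol p g d (cone (b (Suc d)) (j (Suc d)) v) l)"
    by (simp add: fun_eq_iff flip: resol_diff) (simp add: cone_diff[abs_def])
  then show ?case by (simp add: Suc)
qed simp

lemma sphere_eval_coboundary:
  assumes "g ^^ p = id"
  shows "sphere_eval p g b j (Suc d) (coboundary w) = sphere_eval p g b j d (resol p g d w)"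
proof -
  have zero: "sphere_eval p g b j d (\<lambda>l. 0) = 0" for d
    using sphere_eval_diff[of p g b j d "\<lambda>l. 0" "\<lambda>l. 0"] by simp
  have split: "sphere_eval p g b j (Suc d) (coboundary w) =
      sphere_eval p g b j d (resol p g d w) -
      sphere_eval p g b j d (coboundary (resol p g d (cone (b (Suc d)) (j (Suc d)) w)))" for d w
  proof -
    have "resol p g d (cone (b (Suc d)) (j (Suc d)) (coboundary w)) =
      (\<lambda>l. resol p g d w l - coboundary (resol p g d (cone (b (Suc d)) (j (Suc d)) w)) l)"
      by (simp add: fun_eq_iff cone_coboundary[abs_def] resol_diff resol_coboundary)
    then show ?thesis by (simp add: sphere_eval_diff)
  qed
  \<comment> \<open>The error term pairs a coboundary with \<open>resol\<close> of the chain, which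
    is a cycle: in dimension 0 both terms of the difference have the same augmentation, later
    \<open>resol_resol\<close> applies.\<close>
  have "sphere_eval p g b j d (coboundary (resol p g d v)) = 0" for v
  proof (induction d arbitrary: v)
    case 0
    then show ?case by (simp add: resol_def)
  next
    case (Suc d)
    have "sphere_eval p g b j d (resol p g d (resol p g (Suc d) v)) = 0"
      using zero resol_resol[OF assms, of d v] by presburger
    then show ?case
      unfolding split Suc.IH by simp
  qed
  then show ?thesis unfolding split by simp
qed

subsection \<open>Sign vectors\<close>

text \<open>Only the second components below \<open>p\<close> are rotated, so that the \<open>p\<close>-th iterate is the identity
  on the whole type.\<close>

definition shift :: "nat \<Rightarrow> 'a \<times> nat \<Rightarrow> 'a \<times> nat" where
  "shift p x = (fst x, if snd x < p then Suc (snd x) mod p else snd x)"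

lemma fst_shift [simp]: "fst (shift p x) = fst x"
  by (simp add: shift_def)

lemma snd_shift: "snd x < p \<Longrightarrow> snd (shift p x) = Suc (snd x) mod p"
  by (simp add: shift_def)

lemma shift_funpow:
  "(shift p ^^ i) x = (fst x, if snd x < p then (snd x + i) mod p else snd x)"
proof (induction i)
  case (Suc i)
  have "(shift p ^^ Suc i) x = shift p ((shift p ^^ i) x)"
    by simp
  also have "\<dots> = (fst x, if snd x < p then (snd x + Suc i) mod p else snd x)"
    unfolding Suc by (simp add: shift_def mod_Suc_eq)
  finally show ?case .
qed (simp add: prod_eq_iff)

lemma shift_funpow_period [simp]: "shift p ^^ p = id"
  by (simp add: fun_eq_iff shift_funpow)

lemma inj_shift: "inj (shift p)"
proof (cases "p = 0")
  case False
  then obtain q where q: "p = Suc q" by (cases p) auto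
  have "(shift p ^^ q) (shift p x) = x" for x
    using shift_funpow_period[of p] unfolding q funpow_Suc_right
    by (metis comp_apply id_apply)
  then show ?thesis by (metis injI)
qed (auto simp: inj_def shift_def prod_eq_iff)

lemma image_funpow:
  fixes f :: "'a \<Rightarrow> 'a"
  shows "((`) f ^^ i) X = (f ^^ i) ` X"
  by (induction i) (auto simp: image_comp)

text \<open>Nonzero vectors with entries in \<open>\<int>\<^sub>p \<union> {0}\<close>, indexed by \<open>V\<close>, represented by the graph of
  their nonzero part.\<close>

definition sign_vectors :: "nat \<Rightarrow> 'a set \<Rightarrow> ('a \<times> nat) set set" where
  "sign_vectors p V = {X. X \<noteq> {} \<and> X \<subseteq> V \<times> {..<p} \<and> inj_on fst X}"

lemma sign_vectors_mono: "V \<subseteq> W \<Longrightarrow> sign_vectors p V \<subseteq> sign_vectors p W"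
  by (auto simp: sign_vectors_def)

lemma shift_image_sign_vectors:
  assumes "X \<in> sign_vectors p V"
  shows "shift p ` X \<in> sign_vectors p V"
proof -
  have "inj_on fst (shift p ` X)"
    using assms by (auto simp: sign_vectors_def inj_on_def)
  moreover have "shift p ` X \<subseteq> V \<times> {..<p}"
    using assms by (fastforce simp: sign_vectors_def shift_def)
  ultimately show ?thesis
    using assms by (auto simp: sign_vectors_def)
qed

section \<open>Chains of the sphere\<close>

lemma sorted_wrt_subset_map:
  assumes "mono f" and "sorted_wrt (\<subseteq>) l"
  shows "sorted_wrt (\<subseteq>) (map f l)"
  unfolding sorted_wrt_map
  by (rule sorted_wrt_mono_rel[OF _ assms(2)]) (use assms(1) in \<open>auto dest: monoD\<close>)

definition sphere_chain :: "nat \<Rightarrow> nat \<Rightarrow> (nat \<times> nat) set list \<Rightarrow> bool" where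
  "sphere_chain p d l \<longleftrightarrow>
     length l = Suc d \<and> sorted_wrt (\<subseteq>) l \<and> set l \<subseteq> sign_vectors p {..d}"

lemma sphere_chain_map_shift:
  assumes "sphere_chain p d l"
  shows "sphere_chain p d (map (((`) (shift p)) ^^ i) l)"
proof -
  have "sorted_wrt (\<subseteq>) (map (((`) (shift p)) ^^ i) l)"
    using assms unfolding sphere_chain_def
    by (intro sorted_wrt_subset_map) (auto simp: mono_def image_funpow)
  moreover have "(((`) (shift p)) ^^ i) X \<in> sign_vectors p {..d}"
    if "X \<in> sign_vectors p {..d}" for X
    using that by (induction i) (auto intro: shift_image_sign_vectors)
  ultimately show ?thesis
    using assms unfolding sphere_chain_def by auto
qed

text \<open>Coordinate \<open>d\<close> is joined on through
  \<open>X \<subseteq> insert (d, 0) X \<supseteq> {(d, 0)}\<close>; since \<open>X\<close> uses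
  earlier coordinates only, the middle set is again a sign vector.\<close>

abbreviation sphere ::
    "nat \<Rightarrow> nat \<Rightarrow> ((nat \<times> nat) set list \<Rightarrow> int) \<Rightarrow> int" where
  "sphere p \<equiv> sphere_eval p ((`) (shift p)) (\<lambda>d. {(d, 0)}) (\<lambda>d. insert (d, 0))"

lemma insert_sign_vectors:
  assumes "X \<in> sign_vectors p {..d}" and "0 < p"
  shows "insert (Suc d, 0) X \<in> sign_vectors p {..Suc d}"
proof -
  have "Suc d \<notin> fst ` X" "inj_on fst X"
    using assms by (fastforce simp: sign_vectors_def)+
  then have "inj_on fst (insert (Suc d, 0) X)"
    by (subst inj_on_insert) force
  then show ?thesis
    using assms by (auto simp: sign_vectors_def)
qed

lemma resol_cong_mod:
  assumes "\<And>i. [u (map (g ^^ i) l) = v (map (g ^^ i) l)] (mod m)"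
  shows "[resol p g d u l = resol p g d v l] (mod m)"
  using assms[of 0] assms[of 1] assms by (auto simp: resol_def intro!: cong_diff cong_sum)

text \<open>The evaluation sees a cochain only on weakly increasing chains: coning, prism and
  rotation do not leave these.\<close>

lemma sphere_cong_mod:
  assumes "0 < p"
    and "\<And>l. sphere_chain p d l \<Longrightarrow> [u l = v l] (mod m)"
  shows "[sphere p d u = sphere p d v] (mod m)"
  using assms(2)
proof (induction d arbitrary: u v)
  case 0
  have "sphere_chain p 0 [{(0, 0)}]"
    using assms(1) by (auto simp: sphere_chain_def sign_vectors_def)
  with 0 show ?case by simp
next
  case (Suc d)
  let ?j = "insert (Suc d, 0 :: nat)"
  have "[cone {(Suc d, 0)} ?j u l = cone {(Suc d, 0)} ?j v l] (mod m)"
    if l: "sphere_chain p d l" for l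
  proof -
    have sub: "set l \<subseteq> sign_vectors p {..Suc d}"
      using l sign_vectors_mono[of "{..d}" "{..Suc d}" p] by (auto simp: sphere_chain_def)
    have ins: "?j ` set l \<subseteq> sign_vectors p {..Suc d}"
      using l insert_sign_vectors[OF _ assms(1)] by (auto simp: sphere_chain_def)
    have mono: "mono ?j"
      by (auto simp: mono_def)
    have "{(Suc d, 0)} \<in> sign_vectors p {..Suc d}"
      using assms(1) by (simp add: sign_vectors_def)
    then have "sphere_chain p (Suc d) ({(Suc d, 0)} # map ?j l)"
      using l ins sorted_wrt_subset_map[OF mono] by (simp add: sphere_chain_def)
    moreover have "sphere_chain p (Suc d) (l1 @ x # ?j x # map ?j l2)"
      if "l = l1 @ x # l2" for l1 x l2
    proof -
      have "sorted_wrt (\<subseteq>) (map ?j l2)"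
        using l sorted_wrt_subset_map[OF mono] unfolding that
        by (simp add: sphere_chain_def sorted_wrt_append)
      then have "sorted_wrt (\<subseteq>) (l1 @ x # ?j x # map ?j l2)"
        using l unfolding that sphere_chain_def sorted_wrt_append by fastforce
      then show ?thesis
        using l sub ins unfolding that by (auto simp: sphere_chain_def)
    qed
    ultimately show ?thesis
      unfolding cone_def by (intro cong_diff prism_cong_mod Suc.prems)
  qed
  then have "[resol p ((`) (shift p)) d (cone {(Suc d, 0)} ?j u) l =
              resol p ((`) (shift p)) d (cone {(Suc d, 0)} ?j v) l] (mod m)"
    if l: "sphere_chain p d l" for l
    by (intro resol_cong_mod) (use l sphere_chain_map_shift in blast)
  from Suc.IH[OF this] show ?case by simp
qed

abbreviation labels :: "nat \<Rightarrow> (nat \<times> nat) set" where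
  "labels p \<equiv> UNIV \<times> {..<p}"

lemma funpow_shift_labels: "(shift p ^^ i) ` labels p \<subseteq> labels p"
  by (auto simp: shift_funpow)

text \<open>On the target side a cochain is divided by \<open>g - 1\<close> and \<open>1 + g + \<dots> + g\<^sup>p\<^sup>-\<^sup>1\<close> alternately, by
  means of the fundamental domain of label lists that start with the sign \<open>0\<close>.\<close>

lemma ex_divide_norm:
  assumes "normalized u" "0 < p"
    and inv: "\<And>l. length l = Suc d \<Longrightarrow> set l \<subseteq> labels p \<Longrightarrow> [u (map (shift p) l) = u l] (mod m)"
  shows "\<exists>w. normalized w \<and> (\<forall>l. length l = Suc d \<longrightarrow> set l \<subseteq> labels p \<longrightarrow>
           [(\<Sum>i<p. w (map (shift p ^^ i) l)) = u l] (mod m))"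
proof -
  define w where "w l = (if snd (hd l) = 0 then u l else 0)" for l :: "(nat \<times> nat) list"
  have invi: "[u (map (shift p ^^ i) l) = u l] (mod m)"
    if "length l = Suc d" "set l \<subseteq> labels p" for i l
  proof (induction i)
    case (Suc i)
    have "set (map (shift p ^^ i) l) \<subseteq> labels p"
      using funpow_shift_labels[where p = p and i = i] that(2) by auto
    from inv[OF _ this] that(1) Suc show ?case
      by (auto simp: comp_def intro: cong_trans)
  qed simp
  have "[(\<Sum>i<p. w (map (shift p ^^ i) l)) = u l] (mod m)"
    if l: "length l = Suc d" "set l \<subseteq> labels p" for l
  proof -
    have ne: "l \<noteq> []"
      using l(1) by auto
    have "hd l \<in> labels p"
      using l(2) hd_in_set[OF ne] by blast
    then have s: "snd (hd l) < p" by auto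
    \<comment> \<open>The one rotation that gives the head of \<open>l\<close> the sign 0; the outer
      \<open>mod p\<close> covers a head that has it already.\<close>
    define i0 where "i0 = (p - snd (hd l)) mod p"
    have "snd (hd (map (shift p ^^ i) l)) = 0 \<longleftrightarrow> i = i0" if "i < p" for i
    proof -
      have "snd (hd (map (shift p ^^ i) l)) = (snd (hd l) + i) mod p"
        using ne s by (simp add: hd_map shift_funpow)
      moreover have "(snd (hd l) + i) mod p = 0 \<longleftrightarrow> i = i0"
      proof (cases "snd (hd l) = 0")
        case False
        have "(snd (hd l) + i) mod p =
            (if snd (hd l) + i < p then snd (hd l) + i else snd (hd l) + i - p)"
          using s that by (simp add: mod_if)
        with False s that show ?thesis
          by (auto simp: i0_def)
      qed (use that in \<open>simp add: i0_def\<close>)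
      ultimately show ?thesis by simp
    qed
    then have "(\<Sum>i<p. w (map (shift p ^^ i) l)) =
        (\<Sum>i<p. if i = i0 then u (map (shift p ^^ i) l) else 0)"
      unfolding w_def by (intro sum.cong) auto
    also have "\<dots> = u (map (shift p ^^ i0) l)"
      using assms(2) by (simp add: i0_def)
    finally show ?thesis
      using invi[OF l, of i0] by simp
  qed
  moreover have "normalized w"
    using assms(1) by (simp add: normalized_def w_def)
  ultimately show ?thesis by blast
qed

lemma ex_divide_diff:
  assumes "normalized u" "0 < p"
    and norm: "\<And>l. length l = Suc d \<Longrightarrow> set l \<subseteq> labels p \<Longrightarrow>
           [(\<Sum>i<p. u (map (shift p ^^ i) l)) = 0] (mod m)"
  shows "\<exists>w. normalized w \<and> (\<forall>l. length l = Suc d \<longrightarrow> set l \<subseteq> labels p \<longrightarrow>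
           [w (map (shift p) l) - w l = u l] (mod m))"
proof -
  \<comment> \<open>\<open>rep l\<close> is the list in the orbit of \<open>l\<close> whose head has
    sign 0. \<open>w\<close> sums \<open>u\<close> along the orbit from \<open>rep l\<close> to just
    before \<open>l\<close>, so that one shift adds \<open>u l\<close>.\<close>
  define rep where "rep l = map (shift p ^^ (p - snd (hd l))) l" for l :: "(nat \<times> nat) list"
  define w where "w l = (\<Sum>i<snd (hd l). u (map (shift p ^^ i) (rep l)))" for l
  have "[w (map (shift p) l) - w l = u l] (mod m)"
    if l: "length l = Suc d" "set l \<subseteq> labels p" for l
  proof -
    have ne: "l \<noteq> []"
      using l(1) by auto
    have "hd l \<in> labels p"
      using l(2) hd_in_set[OF ne] by blast
    then have s: "snd (hd l) < p" by auto
    have rep: "rep (map (shift p) l) = rep l"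
    proof (cases "Suc (snd (hd l)) = p")
      case True
      then have "snd (hd (map (shift p) l)) = 0" "p - snd (hd l) = 1"
        using ne s by (auto simp: hd_map snd_shift)
      then show ?thesis by (simp add: rep_def)
    next
      case False
      then have "snd (hd (map (shift p) l)) = Suc (snd (hd l))"
        using ne s by (simp add: hd_map snd_shift)
      moreover have "p - snd (hd l) = Suc (p - Suc (snd (hd l)))"
        using s by simp
      ultimately show ?thesis
        by (simp add: rep_def funpow_Suc_right del: funpow.simps)
    qed
    have ret: "map (shift p ^^ snd (hd l)) (rep l) = l"
      using s by (simp add: rep_def flip: funpow_add)
    show ?thesis
    proof (cases "Suc (snd (hd l)) = p")
      case True
      then have "w (map (shift p) l) = 0"
        using ne s by (simp add: w_def hd_map snd_shift)
      \<comment> \<open>Here the shift wraps round to \<open>rep l\<close>, where \<open>w\<close>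
        is 0; the equation holds because \<open>w l + u l\<close> is the sum over the whole
        orbit.\<close>
      moreover have "[(\<Sum>i<Suc (snd (hd l)). u (map (shift p ^^ i) (rep l))) = 0] (mod m)"
        unfolding True using funpow_shift_labels[where p = p and i = "p - snd (hd l)"] l
        by (intro norm) (auto simp: rep_def)
      then have "[w l + u l = 0] (mod m)"
        using ret by (simp add: w_def)
      ultimately show ?thesis
        using dvd_minus_iff[of m "w l + u l"] by (simp add: cong_iff_dvd_diff)
    next
      case False
      then have "snd (hd (map (shift p) l)) = Suc (snd (hd l))"
        using ne s by (simp add: hd_map snd_shift)
      then have "w (map (shift p) l) = w l + u l"
        using ret by (simp add: w_def rep)
      then show ?thesis by simp
    qed
  qed
  moreover have "normalized w"
    using assms(1) by (simp add: normalized_def w_def rep_def del: split_paired_All)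
  ultimately show ?thesis by blast
qed

subsection \<open>The Tucker lemma for cyclic groups\<close>

text \<open>If \<open>u\<close> is \<open>resol\<close> of \<open>w\<close>, then
  \<open>sphere_eval_coboundary\<close> identifies the value of the coboundary of \<open>w\<close>
  on the next chain with that of \<open>u\<close> on the present one. Equivariance of
  \<open>lab\<close> lets \<open>resol\<close> pass through the labelling.\<close>

lemma sphere_cochain:
  fixes lab :: "(nat \<times> nat) set \<Rightarrow> nat \<times> nat"
  assumes "1 < p"
    and lab: "\<And>X. X \<in> sign_vectors p {..<n} \<Longrightarrow> lab X \<in> labels p"
    and equiv: "\<And>X. X \<in> sign_vectors p {..<n} \<Longrightarrow> lab (shift p ` X) = shift p (lab X)"
    and "d < n"
  shows "\<exists>u. normalized u \<and> [sphere p d (\<lambda>l. u (map lab l)) = 1] (mod int p)"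
proof -
  let ?g = "(`) (shift p)"
  have gp: "?g ^^ p = id"
    by (simp add: fun_eq_iff image_funpow)
  \<comment> \<open>The last conjunct is what the next division requires. It is inherited because
    the cochain is itself a coboundary, so that its coboundary vanishes.\<close>
  have "\<exists>v. normalized v \<and>
      [sphere p d (\<lambda>l. coboundary v (map lab l)) = 1] (mod int p) \<and>
      (\<forall>l. length l = Suc d \<longrightarrow> set l \<subseteq> labels p \<longrightarrow>
         [if odd d then coboundary v (map (shift p) l) - coboundary v l
          else \<Sum>i<p. coboundary v (map (shift p ^^ i) l) = 0] (mod int p))"
    using \<open>d < n\<close>
  proof (induction d)
    case 0
    \<comment> \<open>The coboundary of \<open>v\<close> is 1 on every one-entry list; its orbit sum
      is \<open>p\<close>, which is why all values are taken modulo \<open>p\<close>.\<close>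
    define v :: "(nat \<times> nat) list \<Rightarrow> int" where "v l = (if l = [] then 1 else 0)" for l
    have "normalized v"
      by (simp add: normalized_def v_def)
    moreover have "[(\<Sum>i<p. coboundary v (map (shift p ^^ i) l)) = 0] (mod int p)"
      if "length l = Suc 0" for l
    proof -
      obtain x where "l = [x]"
        using \<open>length l = Suc 0\<close> by (auto simp: length_Suc_conv)
      then show ?thesis
        by (simp add: v_def cong_0_iff)
    qed
    moreover have "[sphere p 0 (\<lambda>l. coboundary v (map lab l)) = 1] (mod int p)"
      by (simp add: v_def)
    ultimately show ?case
      by (intro exI[of _ v]) simp
  next
    case (Suc d)
    then obtain v where "normalized v"
      and v: "[sphere p d (\<lambda>l. coboundary v (map lab l)) = 1] (mod int p)"
        "\<forall>l. length l = Suc d \<longrightarrow> set l \<subseteq> labels p \<longrightarrow>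
         [if odd d then coboundary v (map (shift p) l) - coboundary v l
          else \<Sum>i<p. coboundary v (map (shift p ^^ i) l) = 0] (mod int p)"
      by auto
    define u where "u = coboundary v"
    have u: "normalized u"
      unfolding u_def by (rule normalized_coboundary) fact
    note one = v(1)[folded u_def] and cyc = v(2)[folded u_def, rule_format]
    have "\<exists>w. normalized w \<and> (\<forall>l. length l = Suc d \<longrightarrow> set l \<subseteq> labels p \<longrightarrow>
        [resol p (shift p) d w l = u l] (mod int p))"
    proof (cases "odd d")
      case True
      have "\<exists>w. normalized w \<and> (\<forall>l. length l = Suc d \<longrightarrow> set l \<subseteq> labels p \<longrightarrow>
           [(\<Sum>i<p. w (map (shift p ^^ i) l)) = u l] (mod int p))"
        using u assms(1) cyc True by (intro ex_divide_norm) (auto simp: cong_diff_iff_cong_0)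
      with True show ?thesis by (simp add: resol_def)
    next
      case False
      have "\<exists>w. normalized w \<and> (\<forall>l. length l = Suc d \<longrightarrow> set l \<subseteq> labels p \<longrightarrow>
           [w (map (shift p) l) - w l = u l] (mod int p))"
        using u assms(1) cyc False by (intro ex_divide_diff) auto
      with False show ?thesis by (simp add: resol_def)
    qed
    then obtain w where w: "normalized w"
      and div: "\<And>l. length l = Suc d \<Longrightarrow> set l \<subseteq> labels p \<Longrightarrow>
         [resol p (shift p) d w l = u l] (mod int p)"
      by blast
    have "[sphere p (Suc d) (\<lambda>l. coboundary w (map lab l)) = 1] (mod int p)"
    proof -
      have "sphere p (Suc d) (\<lambda>l. coboundary w (map lab l)) =
          sphere p (Suc d) (coboundary (\<lambda>l. w (map lab l)))"
        by (simp add: coboundary_map)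
      also have "\<dots> = sphere p d (resol p ?g d (\<lambda>l. w (map lab l)))"
        by (rule sphere_eval_coboundary[OF gp])
      finally have eq: "sphere p (Suc d) (\<lambda>l. coboundary w (map lab l)) =
        sphere p d (resol p ?g d (\<lambda>l. w (map lab l)))" .
      have "[resol p ?g d (\<lambda>l. w (map lab l)) l = u (map lab l)] (mod int p)"
        if l: "sphere_chain p d l" for l
      proof -
        have "sign_vectors p {..d} \<subseteq> sign_vectors p {..<n}"
          using Suc.prems by (intro sign_vectors_mono) auto
        then have sub: "set l \<subseteq> sign_vectors p {..<n}" and len: "length l = Suc d"
          using l by (auto simp: sphere_chain_def)
        have lab_pow: "lab ((?g ^^ i) X) = (shift p ^^ i) (lab X) \<and>
            (?g ^^ i) X \<in> sign_vectors p {..<n}"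
          if "X \<in> sign_vectors p {..<n}" for i X
          using that by (induction i) (auto simp: equiv shift_image_sign_vectors)
        have pow: "map lab (map (?g ^^ i) l) = map (shift p ^^ i) (map lab l)" for i
          using sub lab_pow by auto
        have "map lab (map ?g l) = map (shift p) (map lab l)"
          using pow[of 1] by (simp del: map_map)
        then have "resol p ?g d (\<lambda>l. w (map lab l)) l = resol p (shift p) d w (map lab l)"
          by (simp only: resol_def pow)
        moreover have "set (map lab l) \<subseteq> labels p"
          using sub lab unfolding set_map by blast
        ultimately show ?thesis
          using div[of "map lab l"] len by simp
      qed
      then have "[sphere p d (resol p ?g d (\<lambda>l. w (map lab l))) =
          sphere p d (\<lambda>l. u (map lab l))] (mod int p)"
        using assms(1) by (intro sphere_cong_mod) auto
      with one show ?thesis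
        unfolding eq by (rule cong_trans[rotated])
    qed
    moreover have "[if odd (Suc d) then coboundary w (map (shift p) l) - coboundary w l
        else \<Sum>i<p. coboundary w (map (shift p ^^ i) l) = 0] (mod int p)"
      if l: "length l = Suc (Suc d)" "set l \<subseteq> labels p" for l
    proof -
      have "[coboundary (resol p (shift p) d w) l = coboundary u l] (mod int p)"
        using l by (intro coboundary_cong_mod div) auto
      then have "[resol p (shift p) d (coboundary w) l = 0] (mod int p)"
        by (simp add: u_def resol_coboundary)
      then show ?thesis
        by (auto simp: resol_def)
    qed
    ultimately show ?case
      using w by blast
  qed
  then show ?thesis
    using normalized_coboundary by blast
qed

lemma adjacent_eq_if_sorted_bounded:
  fixes xs :: "nat list"
  assumes "sorted xs" and "set xs \<subseteq> {..<m}" and "m < length xs"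
  shows "\<exists>i. Suc i < length xs \<and> xs ! i = xs ! Suc i"
proof (rule ccontr)
  assume no: "\<not> ?thesis"
  have "i \<le> xs ! i" if "i < length xs" for i
    using that
  proof (induction i)
    case (Suc i)
    have "xs ! i \<le> xs ! Suc i"
      using assms(1) Suc.prems by (simp add: sorted_iff_nth_mono)
    moreover have "xs ! i \<noteq> xs ! Suc i"
      using no Suc.prems by blast
    ultimately show ?case
      using Suc by simp
  qed simp
  from this[of m] have "m \<le> xs ! m"
    using assms(3) by simp
  moreover have "xs ! m < m"
    using assms(2,3) nth_mem by blast
  ultimately show False by simp
qed

text \<open>If \<open>m < n\<close>, any chain of \<open>n\<close> vectors has two neighbours of
  equal level, hence of equal label by \<open>mono\<close>. A normalized cochain vanishes on such a
  label list, against the value 1.\<close>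

lemma tucker_lessThan:
  assumes "1 < p"
    and level: "\<And>X. X \<in> sign_vectors p {..<n} \<Longrightarrow> lev X < m"
    and sign: "\<And>X. X \<in> sign_vectors p {..<n} \<Longrightarrow> sig X < p"
    and level_shift: "\<And>X. X \<in> sign_vectors p {..<n} \<Longrightarrow> lev (shift p ` X) = lev X"
    and sign_shift: "\<And>X. X \<in> sign_vectors p {..<n} \<Longrightarrow> sig (shift p ` X) = Suc (sig X) mod p"
    and mono: "\<And>X Y. X \<in> sign_vectors p {..<n} \<Longrightarrow> Y \<in> sign_vectors p {..<n} \<Longrightarrow> X \<subseteq> Y \<Longrightarrow>
        lev X \<le> lev Y \<and> (lev X = lev Y \<longrightarrow> sig X = sig Y)"
  shows "n \<le> (m :: nat)"
proof (rule ccontr)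
  assume "\<not> n \<le> m"
  then obtain d where n: "n = Suc d" and "m < n"
    by (cases n) auto
  define lab where "lab X = (lev X, sig X :: nat)" for X
  have "\<exists>u. normalized u \<and> [sphere p d (\<lambda>l. u (map lab l)) = 1] (mod int p)"
  proof (rule sphere_cochain)
    fix X assume X: "X \<in> sign_vectors p {..<n}"
    show "lab X \<in> labels p"
      using sign[OF X] by (simp add: lab_def)
    show "lab (shift p ` X) = shift p (lab X)"
      using sign[OF X] level_shift[OF X] sign_shift[OF X] by (simp add: lab_def shift_def)
  qed (use assms(1) n in simp_all)
  then obtain u where u: "normalized u" "[sphere p d (\<lambda>l. u (map lab l)) = 1] (mod int p)"
    by blast
  have "u (map lab l) = 0" if l: "sphere_chain p d l" for l
  proof -
    have sub: "set l \<subseteq> sign_vectors p {..<n}" and len: "length l = n"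
      using l by (auto simp: sphere_chain_def n lessThan_Suc_atMost)
    have sorted: "sorted_wrt (\<subseteq>) l"
      using l by (simp add: sphere_chain_def)
    have "sorted (map lev l)"
      unfolding sorted_map
      by (rule sorted_wrt_mono_rel[OF _ sorted]) (use sub mono in blast)
    moreover have "set (map lev l) \<subseteq> {..<m}"
      using sub level by auto
    ultimately obtain i where i: "Suc i < n" "lev (l ! i) = lev (l ! Suc i)"
      using adjacent_eq_if_sorted_bounded[of "map lev l" m] \<open>m < n\<close> len by auto
    have "l ! i \<subseteq> l ! Suc i"
      using sorted i(1) len by (auto simp: sorted_wrt_iff_nth_less)
    then have eq: "lab (l ! Suc i) = lab (l ! i)"
      using mono[of "l ! i" "l ! Suc i"] sub i len unfolding lab_def
      by (metis Suc_lessD nth_mem subsetD)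
    have "l = take i l @ l ! i # l ! Suc i # drop (Suc (Suc i)) l"
      using i(1) len by (metis Cons_nth_drop_Suc Suc_lessD id_take_nth_drop)
    then have "map lab l = map lab (take i l @ l ! i # l ! Suc i # drop (Suc (Suc i)) l)"
      by (rule arg_cong)
    also have "\<dots> = map lab (take i l) @ lab (l ! i) # lab (l ! i) #
        map lab (drop (Suc (Suc i)) l)"
      by (simp only: eq map_append list.map)
    finally show ?thesis
      using u(1) unfolding normalized_def by metis
  qed
  then have "[sphere p d (\<lambda>l. u (map lab l)) = sphere p d (\<lambda>l. u (map lab l) - u (map lab l))]
      (mod int p)"
    using assms(1) by (intro sphere_cong_mod) auto
  then have "[0 = 1] (mod int p)"
    unfolding sphere_eval_diff using u(2) cong_sym cong_trans by fastforce
  then show False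
    using assms(1) by (simp add: cong_def)
qed

lemma tucker:
  fixes lev :: "('a \<times> nat) set \<Rightarrow> nat"
  assumes "1 < p" and "finite V"
    and level: "\<And>X. X \<in> sign_vectors p V \<Longrightarrow> lev X < m"
    and sign: "\<And>X. X \<in> sign_vectors p V \<Longrightarrow> sig X < p"
    and level_shift: "\<And>X. X \<in> sign_vectors p V \<Longrightarrow> lev (shift p ` X) = lev X"
    and sign_shift: "\<And>X. X \<in> sign_vectors p V \<Longrightarrow> sig (shift p ` X) = Suc (sig X) mod p"
    and mono: "\<And>X Y. X \<in> sign_vectors p V \<Longrightarrow> Y \<in> sign_vectors p V \<Longrightarrow> X \<subseteq> Y \<Longrightarrow>
        lev X \<le> lev Y \<and> (lev X = lev Y \<longrightarrow> sig X = sig Y)"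
  shows "card V \<le> m"
proof -
  obtain f where f: "bij_betw f {..<card V} V"
    using ex_bij_betw_nat_finite[OF assms(2)] by (auto simp: atLeast0LessThan)
  define F where "F X = map_prod f id ` X" for X :: "(nat \<times> nat) set"
  have F: "F X \<in> sign_vectors p V" if "X \<in> sign_vectors p {..<card V}" for X
  proof -
    have inj: "inj_on f {..<card V}" and img: "f ` {..<card V} = V"
      using f by (auto simp: bij_betw_def)
    have X: "X \<noteq> {}" "X \<subseteq> {..<card V} \<times> {..<p}" "inj_on fst X"
      using that by (auto simp: sign_vectors_def)
    have "inj_on fst (F X)"
    proof (rule inj_onI)
      fix x y assume "x \<in> F X" "y \<in> F X" and eq: "fst x = fst y"
      then obtain x' y' where xy: "x' \<in> X" "y' \<in> X" "x = map_prod f id x'" "y = map_prod f id y'"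
        by (auto simp: F_def)
      then have "f (fst x') = f (fst y')"
        using eq by simp
      then have "fst x' = fst y'"
        using inj X(2) xy(1,2) by (auto dest!: inj_onD)
      then show "x = y"
        using X(3) xy by (auto dest: inj_onD)
    qed
    moreover have "F X \<subseteq> V \<times> {..<p}"
      using X(2) img by (auto simp: F_def)
    ultimately show ?thesis
      using X(1) by (simp add: sign_vectors_def F_def)
  qed
  have sh: "F (shift p ` X) = shift p ` F X" for X
    by (force simp: F_def image_image shift_def)
  have mn: "F X \<subseteq> F Y" if "X \<subseteq> Y" for X Y
    using that by (auto simp: F_def)
  show ?thesis
  proof (rule tucker_lessThan[where lev = "\<lambda>X. lev (F X)" and sig = "\<lambda>X. sig (F X)"])
    fix X Y :: "(nat \<times> nat) set"
    assume "X \<in> sign_vectors p {..<card V}" "Y \<in> sign_vectors p {..<card V}" "X \<subseteq> Y"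
    then show "lev (F X) \<le> lev (F Y) \<and> (lev (F X) = lev (F Y) \<longrightarrow> sig (F X) = sig (F Y))"
      by (intro mono F mn)
  qed (use \<open>1 < p\<close> in \<open>simp_all add: F sh level sign level_shift sign_shift\<close>)
qed

subsection \<open>Colourings and sign vectors\<close>

abbreviation rot :: "nat \<Rightarrow> nat set \<Rightarrow> nat set" where
  "rot p B \<equiv> (\<lambda>i. Suc i mod p) ` B"

lemma inj_on_Suc_mod: "inj_on (\<lambda>i. Suc i mod p) {..<p}"
proof (rule inj_onI)
  fix i j assume "i \<in> {..<p}" "j \<in> {..<p}" "Suc i mod p = Suc j mod p"
  then show "i = j"
    by (auto simp: mod_Suc split: if_splits)
qed

lemma rot_lessThan: "rot p {..<p} = {..<p}"
  by (rule card_subset_eq) (auto simp: card_image inj_on_Suc_mod)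

lemma rot_Collect:
  assumes "\<And>i. i < p \<Longrightarrow> Q (Suc i mod p) \<longleftrightarrow> P i"
  shows "{i. i < p \<and> Q i} = rot p {i. i < p \<and> P i}"
proof -
  have "{i. i < p \<and> Q i} = {i \<in> rot p {..<p}. Q i}"
    unfolding rot_lessThan by auto
  also have "\<dots> = rot p {i. i < p \<and> P i}"
    using assms by auto
  finally show ?thesis .
qed

lemma all_less_rot:
  assumes "\<And>i. i < p \<Longrightarrow> Q (Suc i mod p) \<longleftrightarrow> P i"
  shows "(\<forall>i<p. Q i) \<longleftrightarrow> (\<forall>i<p. P i)"
proof -
  have "(\<forall>i<p. Q i) \<longleftrightarrow> (\<forall>i\<in>rot p {..<p}. Q i)"
    unfolding rot_lessThan by auto
  also have "\<dots> \<longleftrightarrow> (\<forall>i<p. P i)"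
    using assms by auto
  finally show ?thesis .
qed

lemma card_rot: "B \<subseteq> {..<p} \<Longrightarrow> card (rot p B) = card B"
  by (rule card_image) (rule inj_on_subset[OF inj_on_Suc_mod])

text \<open>Since \<open>p\<close> is prime, a nonempty proper subset of \<open>\<int>\<^sub>p\<close> has a centre of mass, which
  moves along with the set.\<close>

definition barycentre :: "nat \<Rightarrow> nat set \<Rightarrow> nat" where
  "barycentre p B = (\<Sum>B * (SOME i. [card B * i = 1] (mod p))) mod p"

text \<open>Rotation adds \<open>card B\<close> to the sum modulo \<open>p\<close>; multiplication
  by the inverse of \<open>card B\<close> turns this into adding 1.\<close>

lemma barycentre_rot:
  assumes "prime p" "B \<subseteq> {..<p}" "B \<noteq> {}" "B \<noteq> {..<p}"
  shows "barycentre p (rot p B) = Suc (barycentre p B) mod p"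
proof -
  have "finite B"
    using assms(2) finite_subset by blast
  have "card B < p"
    using psubset_card_mono[of "{..<p}" B] assms by auto
  moreover have "card B > 0"
    using assms(3) \<open>finite B\<close> by (simp add: card_gt_0_iff)
  ultimately have "\<not> p dvd card B"
    by (auto dest: dvd_imp_le)
  then have "coprime (card B) p"
    using assms(1) by (simp add: prime_imp_coprime coprime_commute)
  then have "\<exists>i. [card B * i = 1] (mod p)"
    using cong_solve_coprime_nat by fastforce
  define c where "c = (SOME i. [card B * i = 1] (mod p))"
  have c: "[card B * c = 1] (mod p)"
    unfolding c_def by (rule someI_ex) fact
  have "\<Sum>(rot p B) = (\<Sum>i\<in>B. Suc i mod p)"
    by (rule sum.reindex[unfolded comp_def id_def]) (rule inj_on_subset[OF inj_on_Suc_mod assms(2)])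
  also have "[\<dots> = (\<Sum>i\<in>B. Suc i)] (mod p)"
    by (rule cong_sum) simp
  also have "(\<Sum>i\<in>B. Suc i) = \<Sum>B + card B"
    by (simp add: sum_Suc)
  finally have "[\<Sum>(rot p B) * c = (\<Sum>B + card B) * c] (mod p)"
    by (rule cong_scalar_right)
  also have "(\<Sum>B + card B) * c = \<Sum>B * c + card B * c"
    by (rule distrib_right)
  also have "[\<dots> = \<Sum>B * c + 1] (mod p)"
    by (rule cong_add) (simp, rule c)
  finally show ?thesis
    unfolding barycentre_def card_rot[OF assms(2)] c_def[symmetric]
    by (simp add: cong_def mod_Suc_eq)
qed

text \<open>Equal sets have equal barycentres, so comparable vectors of one level still get one
  sign.\<close>

lemma tucker_prime:
  fixes lev :: "('a \<times> nat) set \<Rightarrow> nat"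
  assumes "prime p" and "finite V"
    and level: "\<And>X. X \<in> sign_vectors p V \<Longrightarrow> lev X < m"
    and signs: "\<And>X. X \<in> sign_vectors p V \<Longrightarrow> sigs X \<subseteq> {..<p} \<and> sigs X \<noteq> {} \<and> sigs X \<noteq> {..<p}"
    and level_shift: "\<And>X. X \<in> sign_vectors p V \<Longrightarrow> lev (shift p ` X) = lev X"
    and signs_shift: "\<And>X. X \<in> sign_vectors p V \<Longrightarrow> sigs (shift p ` X) = rot p (sigs X)"
    and mono: "\<And>X Y. X \<in> sign_vectors p V \<Longrightarrow> Y \<in> sign_vectors p V \<Longrightarrow> X \<subseteq> Y \<Longrightarrow>
        lev X \<le> lev Y \<and> (lev X = lev Y \<longrightarrow> sigs X = sigs Y)"
  shows "card V \<le> m"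
proof (rule tucker[OF prime_gt_1_nat[OF assms(1)] assms(2)])
  fix X assume X: "X \<in> sign_vectors p V"
  show "lev X < m" "lev (shift p ` X) = lev X"
    using X level level_shift by auto
  show "barycentre p (sigs X) < p"
    using prime_gt_0_nat[OF assms(1)] by (simp add: barycentre_def)
  show "barycentre p (sigs (shift p ` X)) = Suc (barycentre p (sigs X)) mod p"
    unfolding signs_shift[OF X] by (rule barycentre_rot) (use signs[OF X] assms(1) in auto)
next
  fix X Y assume "X \<in> sign_vectors p V" "Y \<in> sign_vectors p V" "X \<subseteq> Y"
  from mono[OF this]
  show "lev X \<le> lev Y \<and> (lev X = lev Y \<longrightarrow> barycentre p (sigs X) = barycentre p (sigs Y))"
    by simp
qed

section \<open>Classes of a sign vector\<close>

definition sign_class :: "('a \<times> nat) set \<Rightarrow> nat \<Rightarrow> 'a set" where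
  "sign_class X i = {v. (v, i) \<in> X}"

lemma sign_class_mono: "X \<subseteq> Y \<Longrightarrow> sign_class X i \<subseteq> sign_class Y i"
  by (auto simp: sign_class_def)

lemma sign_class_subset: "X \<in> sign_vectors p V \<Longrightarrow> sign_class X i \<subseteq> V"
  by (auto simp: sign_class_def sign_vectors_def)

lemma sign_class_disjoint:
  assumes "X \<in> sign_vectors p V" "i \<noteq> j"
  shows "sign_class X i \<inter> sign_class X j = {}"
proof -
  have "inj_on fst X"
    using assms(1) by (simp add: sign_vectors_def)
  then show ?thesis
    using assms(2) inj_onD[of fst X "(v, i)" "(v, j)" for v] by (auto simp: sign_class_def)
qed

lemma sign_class_shift:
  fixes X :: "('a \<times> nat) set"
  assumes "X \<in> sign_vectors p V" "i < p"
  shows "sign_class (shift p ` X) (Suc i mod p) = sign_class X i"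
proof (rule Set.set_eqI)
  fix v :: 'a
  have "(v, Suc i mod p) = shift p (v, i)"
    using assms(2) by (simp add: shift_def)
  then show "v \<in> sign_class (shift p ` X) (Suc i mod p) \<longleftrightarrow> v \<in> sign_class X i"
    using inj_image_mem_iff[OF inj_shift, of p "(v, i)" X] by (simp add: sign_class_def)
qed

lemma sign_vectors_eqI:
  assumes "X \<in> sign_vectors p V" "Y \<in> sign_vectors p V"
    and "\<And>i. i < p \<Longrightarrow> sign_class X i = sign_class Y i"
  shows "X = Y"
  using assms unfolding sign_vectors_def sign_class_def by fast

text \<open>When \<open>E\<close> lacks the empty set, disjointness makes \<open>f\<close>
  injective, and its image is a monochromatic edge of the Kneser hypergraph.\<close>

definition mono_disjoint :: "nat \<Rightarrow> 'a set set \<Rightarrow> ('a set \<Rightarrow> nat) \<Rightarrow> bool" where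
  "mono_disjoint r E col \<longleftrightarrow>
     (\<exists>f c. (\<forall>i<r. f i \<in> E \<and> col (f i) = c) \<and> disjoint_family_on f {..<r})"

definition edge_free :: "nat \<Rightarrow> 'a set set \<Rightarrow> ('a \<times> nat) set \<Rightarrow> bool" where
  "edge_free p E X \<longleftrightarrow> (\<forall>i<p. \<forall>e\<in>E. \<not> e \<subseteq> sign_class X i)"

lemma edge_free_shift:
  "X \<in> sign_vectors p V \<Longrightarrow> edge_free p E (shift p ` X) \<longleftrightarrow> edge_free p E X"
  unfolding edge_free_def by (rule all_less_rot) (simp add: sign_class_shift)

lemma edge_free_mono: "edge_free p E Y \<Longrightarrow> X \<subseteq> Y \<Longrightarrow> edge_free p E X"
  unfolding edge_free_def by (meson order_trans sign_class_mono)

text \<open>Above the \<open>\<alpha>\<close> levels of edge-free vectors, a vector is mapped to the set of pairs \<open>(i, c)\<close>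
  such that its \<open>i\<close>-th class contains an edge of colour \<open>c\<close>. These sets have at most
  \<open>(p - 1) C\<close> elements, for a full colour would give \<open>p\<close> disjoint edges of that colour.\<close>

lemma colouring_bound_prime:
  assumes "prime p" and "finite V" and col: "\<And>e. e \<in> E \<Longrightarrow> col e < C"
    and no_mono: "\<not> mono_disjoint p E col"
    and level: "\<And>X. X \<in> sign_vectors p V \<Longrightarrow> edge_free p E X \<Longrightarrow> lev X < \<alpha>"
    and signs: "\<And>X. X \<in> sign_vectors p V \<Longrightarrow> edge_free p E X \<Longrightarrow>
        sigs X \<subseteq> {..<p} \<and> sigs X \<noteq> {} \<and> sigs X \<noteq> {..<p}"
    and level_shift: "\<And>X. X \<in> sign_vectors p V \<Longrightarrow> edge_free p E X \<Longrightarrow> lev (shift p ` X) = lev X"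
    and signs_shift: "\<And>X. X \<in> sign_vectors p V \<Longrightarrow> edge_free p E X \<Longrightarrow>
        sigs (shift p ` X) = rot p (sigs X)"
    and mono: "\<And>X Y. X \<in> sign_vectors p V \<Longrightarrow> Y \<in> sign_vectors p V \<Longrightarrow> X \<subseteq> Y \<Longrightarrow>
        edge_free p E Y \<Longrightarrow> lev X \<le> lev Y \<and> (lev X = lev Y \<longrightarrow> sigs X = sigs Y)"
  shows "card V \<le> \<alpha> + (p - 1) * C"
proof -
  define T where "T X c = {i. i < p \<and> (\<exists>e\<in>E. e \<subseteq> sign_class X i \<and> col e = c)}" for X c
  define size where "size X = (\<Sum>c<C. card (T X c))" for X
  define least where "least X = (LEAST c. T X c \<noteq> {})" for X
  have T_sub: "T X c \<subseteq> {..<p}" for X c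
    by (auto simp: T_def)
  then have T_fin: "finite (T X c)" for X c
    using finite_subset by blast
  have T_proper: "T X c \<noteq> {..<p}" if X: "X \<in> sign_vectors p V" for X c
  proof
    assume "T X c = {..<p}"
    then have "\<forall>i\<in>{..<p}. \<exists>e. e \<in> E \<and> e \<subseteq> sign_class X i \<and> col e = c"
      unfolding T_def by blast
    then obtain f where f: "\<And>i. i < p \<Longrightarrow> f i \<in> E \<and> f i \<subseteq> sign_class X i \<and> col (f i) = c"
      unfolding bchoice_iff by auto
    have "disjoint_family_on f {..<p}"
      unfolding disjoint_family_on_def
      using f sign_class_disjoint[OF X] by (meson disjoint_iff lessThan_iff subsetD)
    then show False
      using no_mono f unfolding mono_disjoint_def by blast
  qed
  have T_ex: "\<exists>c<C. T X c \<noteq> {}" if "\<not> edge_free p E X" for X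
    using that col unfolding edge_free_def T_def by blast
  have T_least: "T X (least X) \<noteq> {}" if "\<not> edge_free p E X" for X
    unfolding least_def using T_ex[OF that] by (metis (mono_tags, lifting) LeastI)
  have T_shift: "T (shift p ` X) c = rot p (T X c)" if "X \<in> sign_vectors p V" for X c
    unfolding T_def by (rule rot_Collect) (simp add: sign_class_shift[OF that])
  have T_mono: "T X c \<subseteq> T Y c" if "X \<subseteq> Y" for X Y c
    using sign_class_mono[OF that] unfolding T_def by blast
  have size_pos: "0 < size X" if nfree: "\<not> edge_free p E X" for X
  proof -
    obtain c where "c < C" "T X c \<noteq> {}"
      using T_ex[OF nfree] by blast
    then show ?thesis
      unfolding size_def using T_fin by (intro sum_pos2[of _ c]) (auto simp: card_gt_0_iff)
  qed
  have size_le: "size X \<le> (p - 1) * C" if "X \<in> sign_vectors p V" for X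
  proof -
    have "card (T X c) \<le> p - 1" for c
      using psubset_card_mono[OF _ psubsetI[OF T_sub T_proper[OF that]], of c] by simp
    then have "size X \<le> (\<Sum>c<C. p - 1)"
      unfolding size_def by (intro sum_mono)
    then show ?thesis by (simp add: mult.commute)
  qed
  show ?thesis
  \<comment> \<open>\<open>size\<close> is at least 1 on the vectors that contain an edge, hence the
    \<open>- 1\<close>. \<open>least\<close> selects one nonempty \<open>T X c\<close>; the
    selection is unaffected by rotation and depends on \<open>T X\<close> alone.\<close>
  proof (rule tucker_prime[OF assms(1,2),
      where lev = "\<lambda>X. if edge_free p E X then lev X else \<alpha> + size X - 1"
        and sigs = "\<lambda>X. if edge_free p E X then sigs X else T X (least X)"])
    fix X assume X: "X \<in> sign_vectors p V"
    note free = edge_free_shift[OF X, of E]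
    show "(if edge_free p E X then lev X else \<alpha> + size X - 1) < \<alpha> + (p - 1) * C"
      using level[OF X] size_le[OF X] size_pos[of X] by auto
    show "(if edge_free p E X then sigs X else T X (least X)) \<subseteq> {..<p} \<and>
        (if edge_free p E X then sigs X else T X (least X)) \<noteq> {} \<and>
        (if edge_free p E X then sigs X else T X (least X)) \<noteq> {..<p}"
      using signs[OF X] T_sub T_least T_proper[OF X] by auto
    have "size (shift p ` X) = size X"
      unfolding size_def T_shift[OF X] card_rot[OF T_sub] ..
    then show "(if edge_free p E (shift p ` X) then lev (shift p ` X)
          else \<alpha> + size (shift p ` X) - 1) =
        (if edge_free p E X then lev X else \<alpha> + size X - 1)"
      using free level_shift[OF X] by simp
    have "least (shift p ` X) = least X"
      unfolding least_def T_shift[OF X] by simp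
    then show "(if edge_free p E (shift p ` X) then sigs (shift p ` X)
          else T (shift p ` X) (least (shift p ` X))) =
        rot p (if edge_free p E X then sigs X else T X (least X))"
      using free signs_shift[OF X] T_shift[OF X] by simp
  next
    fix X Y assume X: "X \<in> sign_vectors p V" and Y: "Y \<in> sign_vectors p V" and "X \<subseteq> Y"
    have size_mono: "size X \<le> size Y"
      unfolding size_def by (intro sum_mono card_mono T_fin T_mono[OF \<open>X \<subseteq> Y\<close>])
    \<comment> \<open>Each \<open>T X c\<close> lies in \<open>T Y c\<close>, so equal sums of
      cardinalities force equality colour by colour.\<close>
    have T_eq: "T X = T Y" if "size X = size Y" "\<not> edge_free p E X"
    proof
      fix c
      show "T X c = T Y c"
      proof (cases "c < C")
        case True
        have "card (T X c) = card (T Y c)"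
          using sum_mono_inv[OF that(1)[unfolded size_def], of c] True T_fin T_mono[OF \<open>X \<subseteq> Y\<close>]
          by (simp add: card_mono)
        then show ?thesis
          by (rule card_subset_eq[OF T_fin T_mono[OF \<open>X \<subseteq> Y\<close>]])
      next
        case False
        then have "T Z c = {}" for Z
          using col unfolding T_def by blast
        then show ?thesis
          by simp
      qed
    qed
    show "(if edge_free p E X then lev X else \<alpha> + size X - 1)
        \<le> (if edge_free p E Y then lev Y else \<alpha> + size Y - 1) \<and>
      ((if edge_free p E X then lev X else \<alpha> + size X - 1) =
        (if edge_free p E Y then lev Y else \<alpha> + size Y - 1) \<longrightarrow>
       (if edge_free p E X then sigs X else T X (least X)) =
        (if edge_free p E Y then sigs Y else T Y (least Y)))"
    proof (cases "edge_free p E Y")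
      case True
      then show ?thesis
        using mono[OF X Y \<open>X \<subseteq> Y\<close>] edge_free_mono[OF True \<open>X \<subseteq> Y\<close>] by simp
    next
      case False
      show ?thesis
      proof (cases "edge_free p E X")
        case True
        then have "lev X < \<alpha> + size Y - 1"
          using level[OF X] size_pos[OF False] by linarith
        then show ?thesis
          using True False by simp
      next
        case nX: False
        have "T X (least X) = T Y (least Y)" if "\<alpha> + size X - 1 = \<alpha> + size Y - 1"
        proof -
          have "size X = size Y"
            using that size_pos[OF nX] size_pos[OF False] by linarith
          from T_eq[OF this nX] show ?thesis
            by (simp add: least_def)
        qed
        then show ?thesis
          using nX False size_mono by simp
      qed
    qed
  qed
qed

subsection \<open>Equitable families\<close>

definition min_class :: "nat \<Rightarrow> ('a \<times> nat) set \<Rightarrow> nat" where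
  "min_class p X = Min ((\<lambda>i. card (sign_class X i)) ` {..<p})"

definition large_classes :: "nat \<Rightarrow> ('a \<times> nat) set \<Rightarrow> nat set" where
  "large_classes p X = {i. i < p \<and> min_class p X < card (sign_class X i)}"

text \<open>The largest size of a subvector whose class sizes differ by at most one.\<close>

definition equitable_size :: "nat \<Rightarrow> ('a \<times> nat) set \<Rightarrow> nat" where
  "equitable_size p X = p * min_class p X + card (large_classes p X)"

text \<open>If all classes have the same size there are no large ones, and the sign of the smallest
  coordinate takes over. Any equivariant choice works there: comparable vectors of this kind with
  the same \<open>equitable_size\<close> are equal.\<close>

definition equitable_signs :: "nat \<Rightarrow> ('a :: linorder \<times> nat) set \<Rightarrow> nat set" where
  "equitable_signs p X =
     (if large_classes p X = {} then {i. i < p \<and> (Min (fst ` X), i) \<in> X} else large_classes p X)"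

lemma min_class_le: "i < p \<Longrightarrow> min_class p X \<le> card (sign_class X i)"
  unfolding min_class_def by (rule Min_le) auto

lemma min_class_attained:
  assumes "0 < p"
  obtains i where "i < p" "min_class p X = card (sign_class X i)"
proof -
  have "min_class p X \<in> (\<lambda>i. card (sign_class X i)) ` {..<p}"
    unfolding min_class_def using assms by (intro Min_in) auto
  then show thesis using that by auto
qed

lemma large_classes_subset: "large_classes p X \<subseteq> {..<p}"
  by (auto simp: large_classes_def)

lemma finite_large_classes: "finite (large_classes p X)"
  using large_classes_subset finite_subset by blast

lemma card_large_classes_less:
  assumes "0 < p"
  shows "card (large_classes p X) < p"
proof -
  obtain i where "i < p" "min_class p X = card (sign_class X i)"
    by (rule min_class_attained[OF assms])
  then have "large_classes p X \<subset> {..<p}"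
    by (auto simp: large_classes_def)
  from psubset_card_mono[OF finite_lessThan this] show ?thesis
    by simp
qed

text \<open>There are fewer than \<open>p\<close> large classes, so \<open>min_class\<close> is the
  quotient of \<open>equitable_size\<close> by \<open>p\<close>.\<close>

lemma equitable_size_less_iff:
  assumes "0 < p"
  shows "equitable_size p X < p * q \<longleftrightarrow> min_class p X < q"
proof
  assume "min_class p X < q"
  then have "p * Suc (min_class p X) \<le> p * q"
    by (intro mult_le_mono2) simp
  then show "equitable_size p X < p * q"
    using card_large_classes_less[OF assms, of X] by (simp add: equitable_size_def)
next
  assume "equitable_size p X < p * q"
  then have "p * min_class p X < p * q"
    unfolding equitable_size_def by (rule add_lessD1)
  then show "min_class p X < q"
    by simp
qed

lemma sign_class_shift_image:
  assumes "X \<in> sign_vectors p V"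
  shows "(\<lambda>i. f (sign_class (shift p ` X) i)) ` {..<p} = (\<lambda>i. f (sign_class X i)) ` {..<p}"
proof -
  have "(\<lambda>i. f (sign_class (shift p ` X) i)) ` rot p {..<p} = (\<lambda>i. f (sign_class X i)) ` {..<p}"
    unfolding image_image by (rule image_cong) (auto simp: sign_class_shift[OF assms])
  then show ?thesis
    unfolding rot_lessThan .
qed

lemma min_class_shift: "X \<in> sign_vectors p V \<Longrightarrow> min_class p (shift p ` X) = min_class p X"
  unfolding min_class_def by (subst sign_class_shift_image) auto

lemma large_classes_shift:
  "X \<in> sign_vectors p V \<Longrightarrow> large_classes p (shift p ` X) = rot p (large_classes p X)"
  unfolding large_classes_def by (rule rot_Collect) (simp add: min_class_shift sign_class_shift)

lemma equitable_size_shift: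
  "X \<in> sign_vectors p V \<Longrightarrow> equitable_size p (shift p ` X) = equitable_size p X"
  by (simp add: equitable_size_def min_class_shift large_classes_shift card_rot large_classes_subset)

lemma equitable_signs_shift:
  assumes "X \<in> sign_vectors p V"
  shows "equitable_signs p (shift p ` X) = rot p (equitable_signs p X)"
proof -
  have "{i. i < p \<and> (m, i) \<in> shift p ` X} = rot p {i. i < p \<and> (m, i) \<in> X}" for m
    by (rule rot_Collect) (use sign_class_shift[OF assms] in \<open>auto simp: sign_class_def set_eq_iff\<close>)
  moreover have "fst ` shift p ` X = fst ` X"
    by (simp add: image_image)
  ultimately show ?thesis
    by (simp add: equitable_signs_def large_classes_shift[OF assms])
qed

lemma equitable_signs_proper:
  assumes "X \<in> sign_vectors p V" "finite V" "1 < p"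
  shows "equitable_signs p X \<subseteq> {..<p} \<and> equitable_signs p X \<noteq> {} \<and> equitable_signs p X \<noteq> {..<p}"
proof (cases "large_classes p X = {}")
  case True
  have X: "X \<noteq> {}" "X \<subseteq> V \<times> {..<p}" "inj_on fst X"
    using assms(1) by (auto simp: sign_vectors_def)
  then have "finite X"
    using assms(2) finite_subset by blast
  then have "Min (fst ` X) \<in> fst ` X"
    using X(1) by (intro Min_in) auto
  then obtain i where i: "(Min (fst ` X), i) \<in> X"
    by auto
  have "j = i" if "(Min (fst ` X), j) \<in> X" for j
    using inj_onD[OF X(3) _ i that] by simp
  then have "{j. j < p \<and> (Min (fst ` X), j) \<in> X} = {i}"
    using i X(2) by blast
  then have "equitable_signs p X = {i}"
    using True by (simp add: equitable_signs_def)
  moreover have "{i} \<subseteq> {..<p}"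
    using i X(2) by auto
  moreover have "{i} \<noteq> {..<p}"
    using assms(3) by (metis card_lessThan is_singletonI is_singleton_altdef less_irrefl)
  ultimately show ?thesis
    by simp
next
  case False
  have "card (large_classes p X) < card {..<p}"
    using card_large_classes_less[of p X] assms(3) by simp
  then have "large_classes p X \<noteq> {..<p}"
    by (metis less_irrefl)
  then show ?thesis
    using False by (simp add: equitable_signs_def large_classes_subset)
qed

lemma equitable_size_pos:
  assumes "X \<in> sign_vectors p V" "finite V"
  shows "0 < equitable_size p X"
proof (rule ccontr)
  assume "\<not> 0 < equitable_size p X"
  moreover obtain v i where vi: "(v, i) \<in> X" "i < p"
    using assms(1) unfolding sign_vectors_def by fastforce
  ultimately have "min_class p X = 0" "i \<notin> large_classes p X"
    using finite_large_classes[of p X] by (auto simp: equitable_size_def card_eq_0_iff)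
  then have "card (sign_class X i) = 0"
    using vi(2) by (simp add: large_classes_def)
  moreover have "finite (sign_class X i)"
    using sign_class_subset[OF assms(1)] assms(2) finite_subset by blast
  ultimately show False
    using vi(1) by (auto simp: sign_class_def)
qed

text \<open>If the minimum stays, the set of large classes can only grow, and equal size means equal
  sets. If the minimum rises, the size passes a multiple of \<open>p\<close>.\<close>

lemma equitable_mono:
  assumes XY: "X \<in> sign_vectors p V" "Y \<in> sign_vectors p V" "X \<subseteq> Y" and "finite V" "0 < p"
  shows "equitable_size p X \<le> equitable_size p Y \<and>
    (equitable_size p X = equitable_size p Y \<longrightarrow> equitable_signs p X = equitable_signs p Y)"
proof -
  have fin: "finite (sign_class Y i)" for i
    using sign_class_subset[OF XY(2)] assms(4) finite_subset by blast
  have cards: "card (sign_class X i) \<le> card (sign_class Y i)" for i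
    by (rule card_mono[OF fin sign_class_mono[OF XY(3)]])
  obtain i where "i < p" "min_class p Y = card (sign_class Y i)"
    by (rule min_class_attained[OF assms(5)])
  then have min_le: "min_class p X \<le> min_class p Y"
    using min_class_le[of i p X] cards[of i] by simp
  show ?thesis
  proof (cases "min_class p X = min_class p Y")
    case True
    have sub: "large_classes p X \<subseteq> large_classes p Y"
      using True cards by (auto simp: large_classes_def intro: less_le_trans)
    then have le: "card (large_classes p X) \<le> card (large_classes p Y)"
      by (rule card_mono[OF finite_large_classes])
    have "equitable_signs p X = equitable_signs p Y"
      if "equitable_size p X = equitable_size p Y"
    proof -
      have eq: "large_classes p X = large_classes p Y"
        using that True by (intro card_subset_eq[OF finite_large_classes sub])
          (simp add: equitable_size_def)
      show ?thesis
      proof (cases "large_classes p Y = {}")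
        case empty: True
        have "sign_class X j = sign_class Y j" if "j < p" for j
        proof (rule card_subset_eq[OF fin sign_class_mono[OF XY(3)]])
          have "\<not> min_class p Y < card (sign_class Y j)" "\<not> min_class p Y < card (sign_class X j)"
            using that empty eq True by (auto simp: large_classes_def)
          then show "card (sign_class X j) = card (sign_class Y j)"
            using min_class_le[OF that] True by (metis nat_neq_iff leD)
        qed
        then have "X = Y"
          by (rule sign_vectors_eqI[OF XY(1,2)])
        then show ?thesis by simp
      next
        case False
        then show ?thesis
          by (simp add: equitable_signs_def eq)
      qed
    qed
    then show ?thesis
      using True le by (simp add: equitable_size_def)
  next
    case False
    then have "equitable_size p X < p * min_class p Y"
      using min_le equitable_size_less_iff[OF assms(5), of X "min_class p Y"] by linarith
    then have "equitable_size p X < equitable_size p Y"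
      by (simp add: equitable_size_def)
    then show ?thesis by simp
  qed
qed

text \<open>The numbers \<open>(t + i) div r\<close> for \<open>i < r\<close> add up to \<open>t\<close> and differ by at most one. They are
  compatible with composition: dividing \<open>(t + j) div b\<close> into \<open>a\<close> parts in this way gives the
  numbers for \<open>r = a b\<close>.\<close>

definition equitable_free :: "nat \<Rightarrow> 'a set \<Rightarrow> 'a set set \<Rightarrow> nat \<Rightarrow> bool" where
  "equitable_free r V E t \<longleftrightarrow>
     (\<exists>Z. disjoint_family_on Z {..<r} \<and>
        (\<forall>i<r. Z i \<subseteq> V \<and> card (Z i) = (t + i) div r \<and> (\<forall>e\<in>E. \<not> e \<subseteq> Z i)))"

lemma equitable_free_mono:
  assumes "equitable_free r V E t" "finite V" "s \<le> t"
  shows "equitable_free r V E s"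
proof -
  obtain Z where Z: "disjoint_family_on Z {..<r}"
    "\<And>i. i < r \<Longrightarrow> Z i \<subseteq> V" "\<And>i. i < r \<Longrightarrow> card (Z i) = (t + i) div r"
    "\<And>i e. i < r \<Longrightarrow> e \<in> E \<Longrightarrow> \<not> e \<subseteq> Z i"
    using assms(1) unfolding equitable_free_def by blast
  have "\<exists>W. W \<subseteq> Z i \<and> card W = (s + i) div r" if "i < r" for i
    using obtain_subset_with_card_n[of "(s + i) div r" "Z i"] Z(3)[OF that] assms(3)
    by (metis add_le_mono1 div_le_mono)
  then obtain W where W: "\<And>i. i < r \<Longrightarrow> W i \<subseteq> Z i \<and> card (W i) = (s + i) div r"
    by metis
  have "disjoint_family_on W {..<r}"
    using Z(1) W unfolding disjoint_family_on_def by (meson disjoint_iff lessThan_iff subsetD)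
  then show ?thesis
    unfolding equitable_free_def using W Z(2,4) by (intro exI[of _ W]) blast
qed

text \<open>In \<open>equitable_free\<close> the larger parts have the last indices; this
  renumbering puts the large classes there.\<close>

lemma ex_bij_betw_lessThan_upper:
  assumes "B \<subseteq> {..<p}"
  shows "\<exists>f. bij_betw f {..<p} {..<p} \<and> (\<forall>i<p. f i \<in> B \<longleftrightarrow> p - card B \<le> i)"
proof -
  have finB: "finite B" and le: "card B \<le> p"
    using assms finite_subset card_mono[of "{..<p}" B] by auto
  have "card {p - card B..<p} = card B" "card {..<p - card B} = card ({..<p} - B)"
    using le finB assms by (auto simp: card_Diff_subset)
  then obtain g h where g: "bij_betw g {p - card B..<p} B"
    and h: "bij_betw h {..<p - card B} ({..<p} - B)"
    using finite_same_card_bij finB by (metis finite_Diff finite_atLeastLessThan finite_lessThan)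
  let ?f = "\<lambda>i. if i \<in> {p - card B..<p} then g i else h i"
  have "bij_betw ?f ({p - card B..<p} \<union> {..<p - card B}) (B \<union> ({..<p} - B))"
    by (rule bij_betw_disjoint_Un[OF g h]) auto
  moreover have "{p - card B..<p} \<union> {..<p - card B} = {..<p}" "B \<union> ({..<p} - B) = {..<p}"
    using le assms by auto
  moreover have "?f i \<in> B \<longleftrightarrow> p - card B \<le> i" if "i < p" for i
    using that bij_betwE[OF g] bij_betwE[OF h] by auto
  ultimately show ?thesis by (intro exI[of _ ?f]) simp
qed

lemma equitable_free_size:
  assumes X: "X \<in> sign_vectors p V" "edge_free p E X" and "0 < p"
  shows "equitable_free p V E (equitable_size p X)"
proof -
  let ?b = "card (large_classes p X)"
  obtain f where f: "bij_betw f {..<p} {..<p}"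
    "\<And>i. i < p \<Longrightarrow> f i \<in> large_classes p X \<longleftrightarrow> p - ?b \<le> i"
    using ex_bij_betw_lessThan_upper[OF large_classes_subset] by blast
  have f_less: "f i < p" if "i < p" for i
    using bij_betwE[OF f(1)] that by simp
  have b: "?b < p"
    by (rule card_large_classes_less[OF assms(3)])
  have "\<exists>W. W \<subseteq> sign_class X (f i) \<and> card W = (equitable_size p X + i) div p" if "i < p" for i
  proof -
    have "(equitable_size p X + i) div p = min_class p X + (?b + i) div p"
      using assms(3) by (simp add: equitable_size_def add.assoc)
    \<comment> \<open>Exactly the last \<open>?b\<close> parts need one element more, and
      \<open>f\<close> sends those indices to large classes.\<close>
    also have "(?b + i) div p = (if p - ?b \<le> i then 1 else 0)"
      using b that by (auto simp: div_if)
    finally have "(equitable_size p X + i) div p \<le> card (sign_class X (f i))"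
      using f(2)[OF that] min_class_le[OF f_less[OF that], of X]
      by (auto simp: large_classes_def split: if_splits)
    then show ?thesis
      using obtain_subset_with_card_n by metis
  qed
  then obtain W where W: "\<And>i. i < p \<Longrightarrow>
      W i \<subseteq> sign_class X (f i) \<and> card (W i) = (equitable_size p X + i) div p"
    by metis
  have "disjoint_family_on W {..<p}"
    unfolding disjoint_family_on_def
  proof (intro ballI impI)
    fix i j assume ij: "i \<in> {..<p}" "j \<in> {..<p}" "i \<noteq> j"
    then have "f i \<noteq> f j"
      using f(1) by (auto simp: bij_betw_def dest: inj_onD)
    from sign_class_disjoint[OF X(1) this] show "W i \<inter> W j = {}"
      using W ij(1,2) by blast
  qed
  moreover have "W i \<subseteq> V" if "i < p" for i
    using W[OF that] sign_class_subset[OF X(1)] by blast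
  moreover have "\<not> e \<subseteq> W i" if "i < p" "e \<in> E" for i e
    using W[OF that(1)] X(2) f_less[OF that(1)] that(2)
    unfolding edge_free_def by (meson order_trans)
  ultimately show ?thesis
    unfolding equitable_free_def using W by (intro exI[of _ W]) simp
qed

lemma equitable_bound_prime:
  fixes V :: "'a :: linorder set"
  assumes "prime p" "finite V" "\<And>e. e \<in> E \<Longrightarrow> col e < C" "\<not> mono_disjoint p E col"
    and bound: "\<And>t. equitable_free p V E t \<Longrightarrow> t \<le> \<alpha>"
  shows "card V \<le> \<alpha> + (p - 1) * C"
proof (rule colouring_bound_prime[OF assms(1-4),
    where lev = "\<lambda>X. equitable_size p X - 1" and sigs = "equitable_signs p"])
  have p: "1 < p" "0 < p"
    using prime_gt_1_nat[OF assms(1)] by simp_all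
  fix X assume X: "X \<in> sign_vectors p V" "edge_free p E X"
  show "equitable_size p X - 1 < \<alpha>"
    using bound[OF equitable_free_size[OF X p(2)]] equitable_size_pos[OF X(1) assms(2)] by simp
  show "equitable_signs p X \<subseteq> {..<p} \<and> equitable_signs p X \<noteq> {} \<and> equitable_signs p X \<noteq> {..<p}"
    by (rule equitable_signs_proper[OF X(1) assms(2) p(1)])
  show "equitable_size p (shift p ` X) - 1 = equitable_size p X - 1"
    by (simp add: equitable_size_shift[OF X(1)])
  show "equitable_signs p (shift p ` X) = rot p (equitable_signs p X)"
    by (rule equitable_signs_shift[OF X(1)])
next
  fix X Y assume XY: "X \<in> sign_vectors p V" "Y \<in> sign_vectors p V" "X \<subseteq> Y"
  have eq_iff: "equitable_size p X - 1 = equitable_size p Y - 1 \<longleftrightarrow> equitable_size p X = equitable_size p Y"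
    using equitable_size_pos[OF XY(1) assms(2)] equitable_size_pos[OF XY(2) assms(2)] by linarith
  show "equitable_size p X - 1 \<le> equitable_size p Y - 1 \<and>
    (equitable_size p X - 1 = equitable_size p Y - 1 \<longrightarrow> equitable_signs p X = equitable_signs p Y)"
    unfolding eq_iff
    using equitable_mono[OF XY assms(2) prime_gt_0_nat[OF assms(1)]] diff_le_mono by blast
qed

subsection \<open>Composite numbers of classes\<close>

lemma prime_mult_induct [consumes 1, case_names prime mult]:
  fixes r :: nat
  assumes "2 \<le> r"
    and "\<And>p. prime p \<Longrightarrow> P p"
    and "\<And>a b. 2 \<le> a \<Longrightarrow> 2 \<le> b \<Longrightarrow> P a \<Longrightarrow> P b \<Longrightarrow> P (a * b)"
  shows "P r"
  using assms(1)
proof (induction r rule: less_induct)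
  case (less r)
  show ?case
  proof (cases "prime r")
    case False
    obtain p where p: "prime p" "p dvd r"
      using prime_factor_nat[of r] less.prems by auto
    then obtain b where r: "r = p * b"
      by blast
    have "b \<noteq> 0" "b \<noteq> 1"
      using False p(1) less.prems by (auto simp: r)
    then have b: "2 \<le> b"
      by simp
    moreover have "b < r"
      using b prime_gt_1_nat[OF p(1)] by (simp add: r)
    ultimately show ?thesis
      using less.IH[of b] assms(2)[OF p(1)] assms(3)[of p b] prime_ge_2_nat[OF p(1)]
      by (simp add: r)
  qed (rule assms(2))
qed

text \<open>Part \<open>i\<close> of part \<open>j\<close> gets the index
  \<open>l = i * b + j\<close>; with \<open>j\<close> as the remainder, the rounded sizes compose
  correctly.\<close>

lemma disjoint_family_on_mod_div:
  fixes f :: "nat \<Rightarrow> nat \<Rightarrow> 'a set"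
  assumes "disjoint_family_on g {..<b}"
    and "\<And>j. j < b \<Longrightarrow> disjoint_family_on (f j) {..<a}"
    and "\<And>i j. i < a \<Longrightarrow> j < b \<Longrightarrow> f j i \<subseteq> g j"
  shows "disjoint_family_on (\<lambda>l. f (l mod b) (l div b)) {..<a * b}"
  unfolding disjoint_family_on_def
proof (intro ballI impI)
  fix l l' assume "l \<in> {..<a * b}" "l' \<in> {..<a * b}" and "l \<noteq> l'"
  then have div: "l div b < a" "l' div b < a"
    by (simp_all add: less_mult_imp_div_less)
  have "0 < b"
    using \<open>l \<in> {..<a * b}\<close> by (cases b) auto
  then have mod: "l mod b < b" "l' mod b < b"
    by simp_all
  show "f (l mod b) (l div b) \<inter> f (l' mod b) (l' div b) = {}"
  proof (cases "l mod b = l' mod b")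
    case True
    then have "l div b \<noteq> l' div b"
      using \<open>l \<noteq> l'\<close> by (metis div_mult_mod_eq)
    then show ?thesis
      using disjoint_family_onD[OF assms(2)[OF mod(2)]] div True by simp
  next
    case False
    then have "g (l mod b) \<inter> g (l' mod b) = {}"
      using disjoint_family_onD[OF assms(1)] mod by simp
    then show ?thesis
      using assms(3)[OF div(1) mod(1)] assms(3)[OF div(2) mod(2)] by blast
  qed
qed

lemma mono_disjoint_mult:
  assumes "0 < a" and col: "\<And>e. e \<in> E \<Longrightarrow> col e < C"
    and F: "\<And>Y. Y \<in> F \<Longrightarrow> mono_disjoint a {e \<in> E. e \<subseteq> Y} col"
  obtains col' where "\<And>Y. Y \<in> F \<Longrightarrow> col' Y < C"
    and "mono_disjoint b F col' \<Longrightarrow> mono_disjoint (a * b) E col"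
proof -
  have "\<exists>c f. (\<forall>i<a. f i \<in> E \<and> f i \<subseteq> Y \<and> col (f i) = c) \<and> disjoint_family_on f {..<a}"
    if "Y \<in> F" for Y
    using F[OF that] unfolding mono_disjoint_def by blast
  then obtain col' f where
    f: "\<And>Y i. Y \<in> F \<Longrightarrow> i < a \<Longrightarrow> f Y i \<in> E \<and> f Y i \<subseteq> Y \<and> col (f Y i) = col' Y"
    and disj: "\<And>Y. Y \<in> F \<Longrightarrow> disjoint_family_on (f Y) {..<a}"
    by metis
  show thesis
  proof (rule that[of col'])
    show "col' Y < C" if "Y \<in> F" for Y
      using f[OF that assms(1)] col by metis
    assume "mono_disjoint b F col'"
    then obtain g c where g: "\<And>j. j < b \<Longrightarrow> g j \<in> F \<and> col' (g j) = c"
      and g_disj: "disjoint_family_on g {..<b}"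
      unfolding mono_disjoint_def by blast
    let ?h = "\<lambda>l. f (g (l mod b)) (l div b)"
    have "disjoint_family_on ?h {..<a * b}"
      using g_disj g disj f
      by (intro disjoint_family_on_mod_div[where f = "\<lambda>j. f (g j)" and g = g]) auto
    moreover have "?h l \<in> E \<and> col (?h l) = c" if "l < a * b" for l
    proof -
      have "0 < b"
        using that by (cases b) auto
      then have "l mod b < b" "l div b < a"
        using that by (simp_all add: less_mult_imp_div_less)
      then show ?thesis
        using f g by simp
    qed
    ultimately show "mono_disjoint (a * b) E col"
      unfolding mono_disjoint_def by (intro exI[of _ ?h] exI[of _ c]) simp
  qed
qed

text \<open>All \<open>V\<close> and \<open>E\<close> are quantified because the composition uses
  the bound for \<open>b\<close> with a family of larger sets in place of the edges, and the bound
  for \<open>a\<close> inside parts of \<open>V\<close>.\<close>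

definition equitable_bounded :: "nat \<Rightarrow> bool" where
  "equitable_bounded r \<longleftrightarrow> (\<forall>(V :: nat set) E col C \<alpha>.
     finite V \<longrightarrow> {} \<notin> E \<longrightarrow> (\<forall>e\<in>E. col e < C) \<longrightarrow> \<not> mono_disjoint r E col \<longrightarrow>
     (\<forall>t. equitable_free r V E t \<longrightarrow> t \<le> \<alpha>) \<longrightarrow> card V \<le> \<alpha> + (r - 1) * C)"

lemma equitable_bounded_mult:
  assumes "2 \<le> a" "2 \<le> b" and a: "equitable_bounded a" and b: "equitable_bounded b"
  shows "equitable_bounded (a * b)"
  unfolding equitable_bounded_def
proof (intro allI impI)
  fix V :: "nat set" and E col C \<alpha>
  assume "finite V" and ne: "{} \<notin> E" and col: "\<forall>e\<in>E. col e < C"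
    and no_mono: "\<not> mono_disjoint (a * b) E col"
    and bound: "\<forall>t. equitable_free (a * b) V E t \<longrightarrow> t \<le> \<alpha>"
  define F where "F = {Y. Y \<subseteq> V \<and> mono_disjoint a {e \<in> E. e \<subseteq> Y} col}"
  define q where "q = (a - 1) * C"
  have "0 < a" "0 < b"
    using assms by simp_all
  obtain col' where col': "\<And>Y. Y \<in> F \<Longrightarrow> col' Y < C"
    and "mono_disjoint b F col' \<Longrightarrow> mono_disjoint (a * b) E col"
    by (rule mono_disjoint_mult[OF \<open>0 < a\<close>, of E col C F b]) (use col in \<open>auto simp: F_def\<close>)
  then have no_mono': "\<not> mono_disjoint b F col'"
    using no_mono by blast
  have "{} \<notin> F"
    using ne \<open>0 < a\<close> unfolding F_def mono_disjoint_def by auto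
  \<comment> \<open>A set outside \<open>F\<close> with \<open>u + q\<close> elements contains an
    edge-free equitable family of \<open>a\<close> parts and size \<open>u\<close>. Setting aside
    \<open>q\<close> elements in each of the \<open>b\<close> parts thus leaves a family of
    \<open>a * b\<close> parts and size \<open>t - b * q\<close>.\<close>
  have "t \<le> \<alpha> + b * q" if t: "equitable_free b V F t" for t
  proof (cases "t \<le> b * q")
    case False
    then obtain s where s: "t = s + b * q"
      by (metis add.commute le_Suc_ex nat_le_linear)
    obtain Z where Z: "disjoint_family_on Z {..<b}"
      "\<And>j. j < b \<Longrightarrow> Z j \<subseteq> V" "\<And>j. j < b \<Longrightarrow> card (Z j) = (t + j) div b"
      "\<And>j. j < b \<Longrightarrow> \<forall>Y\<in>F. \<not> Y \<subseteq> Z j"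
      using t unfolding equitable_free_def by blast
    have card_Z: "card (Z j) = (s + j) div b + q" if "j < b" for j
    proof -
      have eq: "t + j = s + j + q * b"
        by (simp add: s)
      show ?thesis
        unfolding Z(3)[OF that] eq using \<open>0 < b\<close> by (subst div_mult_self1) simp_all
    qed
    have "equitable_free a (Z j) {e \<in> E. e \<subseteq> Z j} ((s + j) div b)" if j: "j < b" for j
    proof (rule ccontr)
      let ?E = "{e \<in> E. e \<subseteq> Z j}" and ?s = "(s + j) div b"
      assume not_free: "\<not> equitable_free a (Z j) ?E ?s"
      have fin: "finite (Z j)"
        using Z(2)[OF j] \<open>finite V\<close> finite_subset by blast
      have less: "u < ?s" if "equitable_free a (Z j) ?E u" for u
        using equitable_free_mono[OF that fin, of ?s] not_free by (meson not_le)
      \<comment> \<open>The family of empty sets shows that \<open>?s\<close> is positive, so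
        \<open>?s - 1\<close> is an exact subtraction.\<close>
      have "equitable_free a (Z j) ?E 0"
        unfolding equitable_free_def using ne
        by (intro exI[of _ "\<lambda>_. {}"]) (auto simp: disjoint_family_on_def)
      then have "0 < ?s"
        using less by blast
      have "\<not> mono_disjoint a ?E col"
        using Z(2,4)[OF j] by (auto simp: F_def)
      moreover have "\<forall>u. equitable_free a (Z j) ?E u \<longrightarrow> u \<le> ?s - 1"
        using less by fastforce
      ultimately have "card (Z j) \<le> ?s - 1 + q"
        using a[unfolded equitable_bounded_def, rule_format, of "Z j" ?E col C "?s - 1"]
          fin ne col by (simp add: q_def)
      then show False
        using card_Z[OF j] \<open>0 < ?s\<close> by linarith
    qed
    then obtain W where W: "\<And>j. j < b \<Longrightarrow> disjoint_family_on (W j) {..<a} \<and>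
        (\<forall>i<a. W j i \<subseteq> Z j \<and> card (W j i) = ((s + j) div b + i) div a \<and>
          (\<forall>e\<in>{e \<in> E. e \<subseteq> Z j}. \<not> e \<subseteq> W j i))"
      unfolding equitable_free_def by (rule that[OF someI_ex])
    let ?W = "\<lambda>l. W (l mod b) (l div b)"
    have "disjoint_family_on ?W {..<a * b}"
      using Z(1) W by (intro disjoint_family_on_mod_div[where g = Z]) auto
    moreover have "?W l \<subseteq> V \<and> card (?W l) = (s + l) div (a * b) \<and> (\<forall>e\<in>E. \<not> e \<subseteq> ?W l)"
      if "l < a * b" for l
    proof -
      have l: "l mod b < b" "l div b < a"
        using that \<open>0 < b\<close> by (simp_all add: less_mult_imp_div_less)
      have "(s + l mod b) div b + l div b = (s + l mod b + l div b * b) div b"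
        using div_mult_self1[of b "s + l mod b" "l div b"] \<open>0 < b\<close> by linarith
      also have "s + l mod b + l div b * b = s + l"
        by (simp add: add.assoc)
      finally have "((s + l mod b) div b + l div b) div a = (s + l) div (a * b)"
        by (simp only: mult.commute[of a b] div_mult2_eq)
      moreover have "?W l \<subseteq> Z (l mod b)" "card (?W l) = ((s + l mod b) div b + l div b) div a"
        using W[OF l(1)] l(2) by simp_all
      moreover have "\<not> e \<subseteq> ?W l" if "e \<in> E" for e
        using W[OF l(1)] l(2) that by blast
      ultimately show ?thesis
        using Z(2)[OF l(1)] by auto
    qed
    ultimately have "equitable_free (a * b) V E s"
      unfolding equitable_free_def by (intro exI[of _ ?W]) simp
    then show ?thesis
      using bound s by simp
  qed simp
  then have le: "card V \<le> \<alpha> + b * q + (b - 1) * C"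
    using b[unfolded equitable_bounded_def, rule_format, of V F col' C "\<alpha> + b * q"]
      \<open>finite V\<close> \<open>{} \<notin> F\<close> col' no_mono' by blast
  have "b * q + (b - 1) * C = (a * b - 1) * C"
  proof -
    obtain a' b' where "a = Suc a'" "b = Suc b'"
      using \<open>0 < a\<close> \<open>0 < b\<close> gr0_implies_Suc by blast
    then show ?thesis
      by (simp add: q_def algebra_simps)
  qed
  with le show "card V \<le> \<alpha> + (a * b - 1) * C"
    by linarith
qed

lemma equitable_bounded: "2 \<le> r \<Longrightarrow> equitable_bounded r"
proof (induction r rule: prime_mult_induct)
  case (prime p)
  then show ?case
    unfolding equitable_bounded_def using equitable_bound_prime by blast
next
  case (mult a b)
  then show ?case
    by (rule equitable_bounded_mult)
qed

text \<open>The set \<open>A\<close> is a parameter so that \<open>A = {}\<close> covers the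
  ordinary Kneser case, which the composition for small exceptional sets needs.\<close>

definition subsets_not_within :: "'a set \<Rightarrow> 'a set \<Rightarrow> nat \<Rightarrow> 'a set set" where
  "subsets_not_within V A k = {e. e \<subseteq> V \<and> card e = k \<and> \<not> e \<subseteq> A}"

lemma ex_subset_not_within:
  assumes "S \<subseteq> V" "k \<le> card S" "0 < k" "\<not> S \<subseteq> A"
  shows "\<exists>e\<in>subsets_not_within V A k. e \<subseteq> S"
proof -
  obtain x where x: "x \<in> S" "x \<notin> A"
    using assms(4) by blast
  have "finite S"
    using assms(2,3) card.infinite by fastforce
  then have "k - 1 \<le> card (S - {x})"
    using x(1) assms(2) by simp
  then obtain T where T: "T \<subseteq> S - {x}" "card T = k - 1"
    by (meson obtain_subset_with_card_n)
  then have "finite T"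
    using \<open>finite S\<close> finite_subset by blast
  then have "card (insert x T) = k"
    using T assms(3) by (subst card_insert_disjoint) auto
  then show ?thesis
    using T(1) x assms(1) unfolding subsets_not_within_def by (intro bexI[of _ "insert x T"]) auto
qed

subsection \<open>Small exceptional sets\<close>

text \<open>For \<open>k \<le> card A\<close> the equitable bound would be larger by 1, as one class
  of \<open>k\<close> elements fits into \<open>A\<close>.\<close>

definition small_exception_bounded :: "nat \<Rightarrow> bool" where
  "small_exception_bounded r \<longleftrightarrow> (\<forall>(V :: nat set) A k col C.
     finite V \<longrightarrow> finite A \<longrightarrow> 2 \<le> k \<longrightarrow> card A \<le> 2 * (k - 1) \<longrightarrow>
     (\<forall>e\<in>subsets_not_within V A k. col e < C) \<longrightarrow>
     \<not> mono_disjoint r (subsets_not_within V A k) col \<longrightarrow>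
     card V \<le> r * (k - 1) + (r - 1) * C)"

text \<open>The classes of an edge-free vector have fewer than \<open>k\<close> elements, except for at most one class,
  which is contained in \<open>A\<close>. The vectors with all classes of size at least \<open>k - 1\<close> share the top
  level; there, such an exceptional class can only arise by extending the unique class contained in
  \<open>A\<close>.\<close>

lemma small_exception_bounded_prime:
  assumes "prime p"
  shows "small_exception_bounded p"
  unfolding small_exception_bounded_def
proof (intro allI impI)
  fix V A :: "nat set" and k col C
  let ?E = "subsets_not_within V A k"
  assume V: "finite V" and A: "finite A" "card A \<le> 2 * (k - 1)" and k: "2 \<le> k"
    and col: "\<forall>e\<in>?E. col e < C" and no_mono: "\<not> mono_disjoint p ?E col"
  have p: "1 < p" "0 < p"
    using prime_gt_1_nat[OF assms] by simp_all
  define big where "big X = {i. i < p \<and> k \<le> card (sign_class X i)}" for X :: "(nat \<times> nat) set"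
  define inside where "inside X = {i. i < p \<and> sign_class X i \<subseteq> A}" for X
  define top where "top X \<longleftrightarrow> p * (k - 1) \<le> equitable_size p X" for X :: "(nat \<times> nat) set"
  \<comment> \<open>Capping merges all sizes from \<open>p * (k - 1)\<close> on into one level, so
    \<open>sigs\<close> must be constant along inclusions between such vectors.\<close>
  define lev where "lev X = min (equitable_size p X) (p * (k - 1)) - 1" for X :: "(nat \<times> nat) set"
  define sigs where "sigs X =
      (if \<not> top X then equitable_signs p X
       else if big X \<noteq> {} then big X
       else if \<exists>i. inside X = {i} then inside X
       else equitable_signs p X)" for X
  have fin: "finite (sign_class X i)" if "X \<in> sign_vectors p V" for X i
    using sign_class_subset[OF that] V finite_subset by blast
  have big_inside: "sign_class X i \<subseteq> A"
    if "X \<in> sign_vectors p V" "edge_free p ?E X" "i \<in> big X" for X i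
    using ex_subset_not_within[OF sign_class_subset[OF that(1)], of k i A] that(2,3) k
    unfolding edge_free_def big_def by auto
  \<comment> \<open>The origin of the bound \<open>2 * (k - 1)\<close>: disjoint subsets of
    \<open>A\<close> with at least \<open>k - 1\<close> and \<open>k\<close> elements are
    impossible.\<close>
  have two_inside: "card S + card T \<le> 2 * (k - 1)" if "S \<subseteq> A" "T \<subseteq> A" "S \<inter> T = {}" for S T
  proof -
    have "card S + card T = card (S \<union> T)"
      using that A(1) finite_subset by (intro card_Un_disjoint[symmetric]) blast+
    also have "\<dots> \<le> card A"
      using that A(1) by (intro card_mono) auto
    finally show ?thesis using A(2) by simp
  qed
  have big_single: "big X = {i}"
    if X: "X \<in> sign_vectors p V" "edge_free p ?E X" and i: "i \<in> big X" for X i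
  proof -
    have "j = i" if j: "j \<in> big X" for j
    proof (rule ccontr)
      assume "j \<noteq> i"
      then have "card (sign_class X j) + card (sign_class X i) \<le> 2 * (k - 1)"
        by (intro two_inside big_inside[OF X] i j sign_class_disjoint[OF X(1)])
      moreover have "k \<le> card (sign_class X j)" "k \<le> card (sign_class X i)"
        using i j by (simp_all add: big_def)
      ultimately show False
        using k by linarith
    qed
    then show ?thesis
      using i by blast
  qed
  have top_ge: "k - 1 \<le> card (sign_class X i)" if "top X" "i < p" for X i
    using that(1) equitable_size_less_iff[OF p(2), of X "k - 1"] min_class_le[OF that(2), of X]
    unfolding top_def by linarith
  have big_shift: "big (shift p ` X) = rot p (big X)"
    and inside_shift: "inside (shift p ` X) = rot p (inside X)" if "X \<in> sign_vectors p V" for X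
    unfolding big_def inside_def
    by (rule rot_Collect; simp add: sign_class_shift[OF that])+
  have inside_single_shift: "(\<exists>i. rot p (inside X) = {i}) \<longleftrightarrow> (\<exists>i. inside X = {i})" for X
  proof -
    have "card (rot p (inside X)) = card (inside X)"
      by (rule card_rot) (auto simp: inside_def)
    then show ?thesis
      by (metis card_1_singleton_iff One_nat_def)
  qed
  have not_all: "{i} \<noteq> {..<p}" for i
    using p(1) by (metis card_lessThan is_singletonI is_singleton_altdef less_irrefl)
  have "card V \<le> p * (k - 1) + (p - 1) * C"
  proof (rule colouring_bound_prime[OF assms V _ no_mono, where lev = lev and sigs = sigs])
    fix X assume X: "X \<in> sign_vectors p V" "edge_free p ?E X"
    have "0 < p * (k - 1)"
      using p(2) k by simp
    then show "lev X < p * (k - 1)"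
      unfolding lev_def by linarith
    show "sigs X \<subseteq> {..<p} \<and> sigs X \<noteq> {} \<and> sigs X \<noteq> {..<p}"
    proof (cases "top X \<and> (big X \<noteq> {} \<or> (\<exists>i. inside X = {i}))")
      case True
      then have "(\<exists>i. sigs X = {i}) \<and> sigs X \<subseteq> {..<p}"
        using big_single[OF X] by (auto simp: sigs_def big_def inside_def)
      then show ?thesis
        using not_all by auto
    next
      case False
      then have "sigs X = equitable_signs p X"
        by (auto simp: sigs_def)
      then show ?thesis
        using equitable_signs_proper[OF X(1) V p(1)] by simp
    qed
    show "lev (shift p ` X) = lev X"
      by (simp add: lev_def equitable_size_shift[OF X(1)])
    have "top (shift p ` X) = top X"
      by (simp add: top_def equitable_size_shift[OF X(1)])
    then show "sigs (shift p ` X) = rot p (sigs X)"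
      unfolding sigs_def big_shift[OF X(1)] inside_shift[OF X(1)] inside_single_shift
        equitable_signs_shift[OF X(1)] by simp
  next
    fix X Y assume XY: "X \<in> sign_vectors p V" "Y \<in> sign_vectors p V" "X \<subseteq> Y"
      and freeY: "edge_free p ?E Y"
    have freeX: "edge_free p ?E X"
      by (rule edge_free_mono[OF freeY XY(3)])
    have mono: "equitable_size p X \<le> equitable_size p Y"
      "equitable_size p X = equitable_size p Y \<Longrightarrow> equitable_signs p X = equitable_signs p Y"
      using equitable_mono[OF XY V p(2)] by blast+
    have pos: "0 < equitable_size p X"
      by (rule equitable_size_pos[OF XY(1) V])
    have sub: "sign_class X i \<subseteq> sign_class Y i" for i
      by (rule sign_class_mono[OF XY(3)])
    have card_le: "card (sign_class X i) \<le> card (sign_class Y i)" for i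
      by (rule card_mono[OF fin[OF XY(2)] sub])
    have "sigs X = sigs Y" if eq: "lev X = lev Y"
    proof (cases "top X")
      case False
      then have "equitable_size p X = equitable_size p Y" "\<not> top Y"
        using eq mono(1) pos unfolding lev_def top_def by linarith+
      then show ?thesis
        using False mono(2) by (simp add: sigs_def)
    next
      case True
      then have "top Y"
        using mono(1) by (simp add: top_def)
      show ?thesis
      proof (cases "big X = {}")
        case False
        then obtain i where i: "i \<in> big X"
          by blast
        then have "i \<in> big Y"
          using card_le[of i] by (auto simp: big_def)
        then have "big X = {i}" "big Y = {i}"
          using big_single[OF XY(1) freeX i] big_single[OF XY(2) freeY] by auto
        then show ?thesis
          using True \<open>top Y\<close> by (simp add: sigs_def)
      next
        case bigX: True
        have cardX: "card (sign_class X i) = k - 1" if "i < p" for i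
          using top_ge[OF True that] bigX that k by (fastforce simp: big_def)
        show ?thesis
        proof (cases "big Y = {}")
          case bigY: True
          have "sign_class X i = sign_class Y i" if "i < p" for i
          proof (rule card_subset_eq[OF fin[OF XY(2)] sub])
            have "card (sign_class Y i) = k - 1"
              using top_ge[OF \<open>top Y\<close> that] bigY that k by (fastforce simp: big_def)
            then show "card (sign_class X i) = card (sign_class Y i)"
              using cardX[OF that] by simp
          qed
          then have "X = Y"
            by (rule sign_vectors_eqI[OF XY(1,2)])
          then show ?thesis by simp
        next
          case False
          then obtain i where i: "i \<in> big Y"
            by blast
          then have bigY: "big Y = {i}" and i_inside: "sign_class Y i \<subseteq> A"
            by (rule big_single[OF XY(2) freeY], rule big_inside[OF XY(2) freeY])
          \<comment> \<open>A second class of \<open>X\<close> inside \<open>A\<close> would have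
            \<open>k - 1\<close> elements and be disjoint from the big class of \<open>Y\<close>.
            Hence the sign of \<open>X\<close> already predicts which class becomes big.\<close>
          have "j = i" if j: "j \<in> inside X" for j
          proof (rule ccontr)
            assume "j \<noteq> i"
            then have "sign_class X j \<inter> sign_class Y i = {}"
              using sub[of j] sign_class_disjoint[OF XY(2), of j i] by blast
            then have "card (sign_class X j) + card (sign_class Y i) \<le> 2 * (k - 1)"
              using j i_inside by (intro two_inside) (auto simp: inside_def)
            moreover have "card (sign_class X j) = k - 1" "k \<le> card (sign_class Y i)"
              using j i cardX by (auto simp: inside_def big_def)
            ultimately show False
              using k by linarith
          qed
          moreover have "i \<in> inside X"
            using i i_inside sub[of i] by (auto simp: inside_def big_def)
          ultimately have "inside X = {i}"
            by blast
          then show ?thesis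
            using True \<open>top Y\<close> bigX bigY by (simp add: sigs_def)
        qed
      qed
    qed
    moreover have "lev X \<le> lev Y"
      unfolding lev_def using mono(1) by (intro diff_le_mono min.mono) simp_all
    ultimately show "lev X \<le> lev Y \<and> (lev X = lev Y \<longrightarrow> sigs X = sigs Y)"
      by blast
  qed (use col in blast)
  then show "card V \<le> p * (k - 1) + (p - 1) * C" .
qed

text \<open>The exceptional set is dealt with in the step for \<open>a\<close>; the step for
  \<open>b\<close> concerns all \<open>K\<close>-subsets of \<open>V\<close>.\<close>

lemma small_exception_bounded_mult:
  assumes "2 \<le> a" "2 \<le> b" and a: "small_exception_bounded a" and b: "small_exception_bounded b"
  shows "small_exception_bounded (a * b)"
  unfolding small_exception_bounded_def
proof (intro allI impI)
  fix V A :: "nat set" and k col C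
  let ?E = "\<lambda>Y. subsets_not_within Y A k"
  assume V: "finite V" and A: "finite A" "card A \<le> 2 * (k - 1)" and k: "2 \<le> k"
    and col: "\<forall>e\<in>?E V. col e < C" and no_mono: "\<not> mono_disjoint (a * b) (?E V) col"
  \<comment> \<open>One more than the bound for \<open>a\<close>, so every set of \<open>K\<close>
    vertices contains \<open>a\<close> disjoint edges of one colour.\<close>
  define K where "K = a * (k - 1) + (a - 1) * C + 1"
  define F where "F = subsets_not_within V {} K"
  have "0 < a"
    using assms(1) by simp
  have "0 < a * (k - 1)"
    using assms(1) k by simp
  then have "2 \<le> K"
    unfolding K_def by linarith
  have mono: "mono_disjoint a {e \<in> ?E V. e \<subseteq> Y} col" if "Y \<in> F" for Y
  proof (rule ccontr)
    assume not_mono: "\<not> ?thesis"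
    have Y: "Y \<subseteq> V" "card Y = K"
      using that by (auto simp: F_def subsets_not_within_def)
    have eq: "{e \<in> ?E V. e \<subseteq> Y} = ?E Y"
      using Y(1) by (auto simp: subsets_not_within_def)
    have "finite Y" "\<forall>e\<in>?E Y. col e < C"
      using Y(1) V col finite_subset by (auto simp flip: eq)
    then have "card Y \<le> a * (k - 1) + (a - 1) * C"
      using a[unfolded small_exception_bounded_def, rule_format, of Y A k col C] A k not_mono
      unfolding eq by blast
    then show False
      using Y(2) by (simp add: K_def)
  qed
  obtain col' where "\<And>Y. Y \<in> F \<Longrightarrow> col' Y < C"
    and "mono_disjoint b F col' \<Longrightarrow> mono_disjoint (a * b) (?E V) col"
    by (rule mono_disjoint_mult[OF \<open>0 < a\<close>, of "?E V" col C F b]) (use col mono in auto)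
  then have "card V \<le> b * (K - 1) + (b - 1) * C"
    using b[unfolded small_exception_bounded_def, rule_format, of V "{}" K col' C] V \<open>2 \<le> K\<close> no_mono
    unfolding F_def by (metis card.empty finite.emptyI le0)
  moreover have "b * (K - 1) + (b - 1) * C = a * b * (k - 1) + (a * b - 1) * C"
  proof -
    obtain a' b' k' where "a = Suc a'" "b = Suc b'" "k = Suc k'"
      using assms(1,2) k by (metis Suc_le_D numeral_2_eq_2)
    then show ?thesis
      by (simp add: K_def algebra_simps)
  qed
  ultimately show "card V \<le> a * b * (k - 1) + (a * b - 1) * C"
    by simp
qed

lemma small_exception_bounded: "2 \<le> r \<Longrightarrow> small_exception_bounded r"
  by (induction r rule: prime_mult_induct)
     (auto intro: small_exception_bounded_prime small_exception_bounded_mult)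

subsection \<open>Chromatic numbers\<close>

lemma edges_hyp: "edges (hyp n k a) = subsets_not_within {1..n} {n - a + 1..n} k"
  by (simp add: hyp_def subsets_not_within_def)

lemma KG_colouring:
  assumes "2 \<le> r" "0 < k"
  obtains col where
    "\<forall>e\<in>subsets_not_within {1..n} {n - a + 1..n} k. col e < chromatic_number (KG r n k a)"
    and "\<not> mono_disjoint r (subsets_not_within {1..n} {n - a + 1..n} k) col"
proof -
  let ?E = "subsets_not_within {1..n} {n - a + 1..n} k"
  obtain col where col: "proper_coloring (KG r n k a) (chromatic_number (KG r n k a)) col"
    using KG_chromatic_number_attained[OF assms(1)] by blast
  have "\<not> mono_disjoint r ?E col"
  proof
    assume "mono_disjoint r ?E col"
    then obtain f c where f: "\<And>i. i < r \<Longrightarrow> f i \<in> ?E \<and> col (f i) = c"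
      and disj: "disjoint_family_on f {..<r}"
      unfolding mono_disjoint_def by blast
    have ne: "f i \<noteq> {}" if "i < r" for i
      using f[OF that] assms(2) by (auto simp: subsets_not_within_def)
    have "inj_on f {..<r}"
      using disjoint_family_onD[OF disj] ne by (intro inj_onI) (metis Int_absorb lessThan_iff)
    then have "card (f ` {..<r}) = r"
      by (simp add: card_image)
    moreover have "pairwise disjnt (f ` {..<r})"
      using disjoint_family_onD[OF disj] by (auto simp: pairwise_def disjnt_def)
    moreover have "f ` {..<r} \<subseteq> ?E"
      using f by auto
    ultimately have "f ` {..<r} \<in> edges (KG r n k a)"
      by (simp add: KG_def kneser_def edges_hyp)
    moreover have "monochromatic col (f ` {..<r})"
      using f by (auto simp: monochromatic_def)
    ultimately show False
      using col by (auto simp: proper_coloring_def)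
  qed
  moreover have "\<forall>e\<in>?E. col e < chromatic_number (KG r n k a)"
    using col by (auto simp: proper_coloring_def KG_def kneser_def edges_hyp)
  ultimately show thesis
    by (rule that[rotated])
qed

section \<open>Lower bounds in the three ranges of \<open>a\<close>\<close>

lemma chromatic_number_KG_lower:
  assumes "2 \<le> r" "2 \<le> k" "a < n" "a \<le> 2 * (k - 1)"
  shows "n \<le> r * (k - 1) + (r - 1) * chromatic_number (KG r n k a)"
proof -
  let ?A = "{n - a + 1..n}"
  obtain col where "\<forall>e\<in>subsets_not_within {1..n} ?A k. col e < chromatic_number (KG r n k a)"
    and "\<not> mono_disjoint r (subsets_not_within {1..n} ?A k) col"
    by (rule KG_colouring[of r k n a]) (use assms in simp_all)
  moreover have "card ?A = a"
    using assms(3) by simp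
  ultimately have "card {1..n} \<le> r * (k - 1) + (r - 1) * chromatic_number (KG r n k a)"
    using small_exception_bounded[OF assms(1), unfolded small_exception_bounded_def, rule_format,
        of "{1..n}" ?A k col] assms by simp
  then show ?thesis by simp
qed

text \<open>Hermite's identity. Raising \<open>t\<close> by 1 shifts the summands, replacing
  \<open>t div r\<close> by \<open>(t + r) div r\<close>.\<close>

lemma sum_div_consecutive:
  fixes t r :: nat
  assumes "0 < r"
  shows "(\<Sum>i<r. (t + i) div r) = t"
proof (induction t)
  case 0
  then show ?case by simp
next
  case (Suc t)
  obtain q where r: "r = Suc q"
    using assms gr0_implies_Suc by blast
  have "(\<Sum>i<r. (Suc t + i) div r) = (\<Sum>i<q. (t + Suc i) div r) + (t + r) div r"
    by (simp add: r)
  also have "(t + r) div r = Suc (t div r)"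
    using assms by simp
  also have "(\<Sum>i<q. (t + Suc i) div r) + Suc (t div r) = Suc (\<Sum>i<r. (t + i) div r)"
    unfolding r sum.lessThan_Suc_shift by simp
  finally show ?case
    using Suc by simp
qed

lemma chromatic_number_KG_lower_equitable:
  assumes "2 \<le> r" "2 \<le> k" "a < n"
    and bound: "\<And>t Z. disjoint_family_on Z {..<r} \<Longrightarrow>
      (\<And>i. i < r \<Longrightarrow> card (Z i) = (t + i) div r \<and> (k \<le> card (Z i) \<longrightarrow> Z i \<subseteq> {n - a + 1..n})) \<Longrightarrow>
      t \<le> \<alpha>"
  shows "n \<le> \<alpha> + (r - 1) * chromatic_number (KG r n k a)"
proof -
  let ?E = "subsets_not_within {1..n} {n - a + 1..n} k"
  obtain col where col: "\<forall>e\<in>?E. col e < chromatic_number (KG r n k a)" "\<not> mono_disjoint r ?E col"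
    by (rule KG_colouring[of r k n a]) (use assms in simp_all)
  have "t \<le> \<alpha>" if free: "equitable_free r {1..n} ?E t" for t
  proof -
    obtain Z where Z: "disjoint_family_on Z {..<r}"
      "\<And>i. i < r \<Longrightarrow> Z i \<subseteq> {1..n} \<and> card (Z i) = (t + i) div r \<and> (\<forall>e\<in>?E. \<not> e \<subseteq> Z i)"
      using free unfolding equitable_free_def by blast
    have "Z i \<subseteq> {n - a + 1..n}" if "i < r" "k \<le> card (Z i)" for i
    proof (rule ccontr)
      assume "\<not> Z i \<subseteq> {n - a + 1..n}"
      then have "\<exists>e\<in>?E. e \<subseteq> Z i"
        using Z(2)[OF that(1)] that(2) assms(2) by (intro ex_subset_not_within) auto
      then show False
        using Z(2)[OF that(1)] by blast
    qed
    then show ?thesis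
      using Z by (intro bound[of Z]) auto
  qed
  moreover have "{} \<notin> ?E"
    by (simp add: subsets_not_within_def)
  ultimately have "card {1..n} \<le> \<alpha> + (r - 1) * chromatic_number (KG r n k a)"
    using col
    by (intro equitable_bounded[OF assms(1), unfolded equitable_bounded_def, rule_format,
        of "{1..n}" ?E col]) auto
  then show ?thesis by simp
qed

lemma disjoint_cards_le:
  assumes "disjoint_family_on Z I" "finite I" "finite A" "\<And>i. i \<in> I \<Longrightarrow> Z i \<subseteq> A"
  shows "(\<Sum>i\<in>I. card (Z i)) \<le> card A"
proof -
  have "(\<Sum>i\<in>I. card (Z i)) = card (\<Union>i\<in>I. Z i)"
  proof (rule card_UN_disjoint[symmetric])
    show "\<forall>i\<in>I. finite (Z i)"
      using assms(3,4) by (meson finite_subset)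
    show "\<forall>i\<in>I. \<forall>j\<in>I. i \<noteq> j \<longrightarrow> Z i \<inter> Z j = {}"
      using assms(1) by (simp add: disjoint_family_on_def)
  qed (rule assms(2))
  also have "\<dots> \<le> card A"
    using assms(3,4) by (intro card_mono) auto
  finally show ?thesis .
qed

text \<open>For \<open>r * k \<le> t\<close> every part has at least \<open>k\<close> elements, so
  all \<open>t\<close> elements lie in \<open>A\<close>. Otherwise only the parts of exactly
  \<open>k\<close> elements are forced into \<open>A\<close>, and at most \<open>a div k\<close>
  fit.\<close>

lemma equitable_size_bound:
  fixes r k a t :: nat
  assumes "0 < r" "finite A" "card A = a"
    and "disjoint_family_on Z {..<r}"
    and Z: "\<And>i. i < r \<Longrightarrow> card (Z i) = (t + i) div r \<and> (k \<le> card (Z i) \<longrightarrow> Z i \<subseteq> A)"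
  shows "r * k \<le> t \<Longrightarrow> t \<le> a"
    and "t < r * k \<Longrightarrow> t \<le> r * (k - 1) + a div k"
proof -
  assume "r * k \<le> t"
  have "Z i \<subseteq> A" if "i < r" for i
  proof -
    have "k \<le> (t + i) div r"
      using \<open>r * k \<le> t\<close> assms(1) by (simp add: less_eq_div_iff_mult_less_eq mult.commute)
    then show ?thesis
      using Z[OF that] by simp
  qed
  then have "(\<Sum>i<r. card (Z i)) \<le> a"
    using disjoint_cards_le[OF assms(4) _ assms(2)] assms(3) by simp
  then show "t \<le> a"
    using Z sum_div_consecutive[OF assms(1), of t] by simp
next
  assume less: "t < r * k"
  show "t \<le> r * (k - 1) + a div k"
  proof (rule ccontr)
    assume not_le: "\<not> ?thesis"
    have "0 < k"
      using less by (cases k) auto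
    \<comment> \<open>The excess over \<open>r * (k - 1)\<close> is the number of parts with
      \<open>k\<close> elements, which are the last \<open>b\<close> ones.\<close>
    define b where "b = t - r * (k - 1)"
    have t: "t = r * (k - 1) + b"
      using not_le by (simp add: b_def)
    have "r * k = r * (k - 1) + r"
      using \<open>0 < k\<close> by (cases k) auto
    then have "b < r" and "a div k < b"
      using less not_le by (simp_all add: t)
    have "(t + i) div r = k" if "r - b \<le> i" "i < r" for i
    proof -
      have "t + i = r * k + (b + i - r)"
        using \<open>r * k = r * (k - 1) + r\<close> that by (simp add: t)
      moreover have "b + i - r < r"
        using \<open>b < r\<close> that by linarith
      ultimately show ?thesis
        by simp
    qed
    then have "card (Z i) = k \<and> Z i \<subseteq> A" if "i \<in> {r - b..<r}" for i
      using Z[of i] that by auto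
    moreover have "disjoint_family_on Z {r - b..<r}"
      using assms(4) by (rule disjoint_family_on_mono[rotated]) auto
    ultimately have "(\<Sum>i\<in>{r - b..<r}. card (Z i)) \<le> a" "(\<Sum>i\<in>{r - b..<r}. card (Z i)) = b * k"
      using disjoint_cards_le[of Z "{r - b..<r}" A] assms(2,3) \<open>b < r\<close> by simp_all
    then have "b \<le> a div k"
      using \<open>0 < k\<close> by (simp add: less_eq_div_iff_mult_less_eq)
    with \<open>a div k < b\<close> show False by simp
  qed
qed

text \<open>A family of size below \<open>r * k\<close> already satisfies
  \<open>t \<le> r * k - 1 \<le> a\<close>, which explains the threshold.\<close>

lemma chromatic_number_KG_lower_large:
  assumes "2 \<le> r" "2 \<le> k" "a < n" "r * k - 1 \<le> a"
  shows "n \<le> a + (r - 1) * chromatic_number (KG r n k a)"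
proof (rule chromatic_number_KG_lower_equitable[OF assms(1-3)])
  fix t Z
  assume Z: "disjoint_family_on Z {..<r}"
    "\<And>i. i < r \<Longrightarrow> card (Z i) = (t + i) div r \<and> (k \<le> card (Z i) \<longrightarrow> Z i \<subseteq> {n - a + 1..n})"
  have "0 < r" "card {n - a + 1..n} = a"
    using assms(1,3) by simp_all
  note equitable_size_bound(1)[OF this(1) finite_atLeastAtMost this(2) Z]
  then show "t \<le> a"
    using assms(4) by linarith
qed

lemma chromatic_number_KG_lower_middle:
  assumes "2 \<le> r" "2 \<le> k" "a < n" "a < r * k"
  shows "n \<le> r * (k - 1) + a div k + (r - 1) * chromatic_number (KG r n k a)"
proof (rule chromatic_number_KG_lower_equitable[OF assms(1-3)])
  fix t Z
  assume Z: "disjoint_family_on Z {..<r}"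
    "\<And>i. i < r \<Longrightarrow> card (Z i) = (t + i) div r \<and> (k \<le> card (Z i) \<longrightarrow> Z i \<subseteq> {n - a + 1..n})"
  have "0 < r" "card {n - a + 1..n} = a"
    using assms(1,3) by simp_all
  note equitable_size_bound[OF this(1) finite_atLeastAtMost this(2) Z]
  then show "t \<le> r * (k - 1) + a div k"
    using assms(4) by linarith
qed

text \<open>Colour an edge by the block of length \<open>r - 1\<close> that contains its minimum; pairwise disjoint
  edges have distinct minima. All edges with late minima share the last colour.\<close>

lemma chromatic_number_KG_upper:
  assumes "2 \<le> r" "0 < k" "0 < m" and n: "n \<le> r * (k - 1) + (r - 1) * m \<or> n \<le> a + (r - 1) * m"
  shows "chromatic_number (KG r n k a) \<le> m"
proof -
  let ?E = "subsets_not_within {1..n} {n - a + 1..n} k"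
  define d where "d = r - 1"
  have "0 < d"
    using assms(1) by (simp add: d_def)
  define col where "col e = min ((Min e - 1) div d) (m - 1)" for e :: "nat set"
  have Min: "Min e \<in> e" "finite e" "1 \<le> Min e" if "e \<in> ?E" for e
  proof -
    have e: "e \<subseteq> {1..n}" "e \<noteq> {}"
      using that assms(2) by (auto simp: subsets_not_within_def)
    then show "finite e"
      using finite_subset by blast
    then show "Min e \<in> e"
      using e(2) by (rule Min_in)
    then show "1 \<le> Min e"
      using e(1) by auto
  qed
  have "\<not> monochromatic col S" if S: "S \<subseteq> ?E" "card S = r" "pairwise disjnt S" for S
  proof
    assume "monochromatic col S"
    then obtain c where c: "\<And>e. e \<in> S \<Longrightarrow> col e = c"
      by (auto simp: monochromatic_def)
    have "finite S"
      using S(2) assms(1) card.infinite by fastforce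
    have "inj_on Min S"
    proof (rule inj_onI)
      fix e e' assume ee: "e \<in> S" "e' \<in> S" "Min e = Min e'"
      then have "Min e \<in> e \<inter> e'"
        using Min(1) S(1) by (metis IntI subsetD)
      then show "e = e'"
        using S(3) ee by (auto simp: pairwise_def disjnt_def)
    qed
    then have card_Min: "card (Min ` S) = r"
      using S(2) by (simp add: card_image)
    \<comment> \<open>A block has \<open>d = r - 1\<close> numbers, too few for \<open>r\<close>
      distinct minima; hence only the capped last colour remains.\<close>
    have not_block: "\<not> Min ` S \<subseteq> {c * d + 1..c * d + d}"
      using card_mono[of "{c * d + 1..c * d + d}" "Min ` S"] card_Min assms(1) by (auto simp: d_def)
    have block: "Min e \<in> {c * d + 1..c * d + d}" if "e \<in> S" "(Min e - 1) div d = c" for e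
    proof -
      have "c * d \<le> Min e - 1" "Min e - 1 < d + c * d"
        using that(2) div_times_less_eq_dividend[of "Min e - 1" d]
          dividend_less_div_times[OF \<open>0 < d\<close>, of "Min e - 1"] by simp_all
      then show ?thesis
        using Min(3) S(1) that(1) by fastforce
    qed
    obtain e where e: "e \<in> S" "(Min e - 1) div d \<noteq> c"
      using block not_block by blast
    then have c_def: "c = m - 1"
      using c[of e] by (auto simp: col_def min_def split: if_splits)
    have "m = Suc c"
      using assms(3) c_def by simp
    have le: "c * d + 1 \<le> Min e'" if "e' \<in> S" for e'
    proof -
      have "c \<le> (Min e' - 1) div d"
        using c[OF that] by (simp add: col_def min_def split: if_splits)
      then have "c * d \<le> Min e' - 1"
        using \<open>0 < d\<close> by (simp add: less_eq_div_iff_mult_less_eq)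
      then show ?thesis
        using Min(3) S(1) that by fastforce
    qed
    show False
      using n
    proof
      \<comment> \<open>The edges need \<open>r * k\<close> numbers beyond \<open>c * d\<close>, but
        there are at most \<open>r * (k - 1) + d = r * k - 1\<close>.\<close>
      assume n: "n \<le> r * (k - 1) + (r - 1) * m"
      have "(\<Sum>e\<in>S. card e) \<le> card {c * d + 1..n}"
      proof (rule disjoint_cards_le)
        show "disjoint_family_on (\<lambda>e. e) S"
          using S(3) by (auto simp: pairwise_def disjnt_def disjoint_family_on_def)
        fix e assume "e \<in> S"
        then have "e \<in> ?E"
          using S(1) by blast
        then have "e \<subseteq> {1..n}" "finite e"
          by (simp add: subsets_not_within_def, rule Min(2))
        moreover have "c * d + 1 \<le> x" if "x \<in> e" for x
          using le[OF \<open>e \<in> S\<close>] Min_le[OF \<open>finite e\<close> that] by simp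
        ultimately show "e \<subseteq> {c * d + 1..n}"
          by auto
      qed (simp_all add: \<open>finite S\<close>)
      moreover have "(\<Sum>e\<in>S. card e) = r * k"
        using S(1,2) by (subst sum.cong[OF refl, of _ _ "\<lambda>_. k"]) (auto simp: subsets_not_within_def)
      ultimately have "r * k \<le> n - c * d"
        by simp
      moreover have "n \<le> r * (k - 1) + d + c * d"
        using n by (simp add: d_def \<open>m = Suc c\<close> mult.commute)
      moreover have "r * k = r * (k - 1) + Suc d"
        using assms(1,2) by (cases k) (auto simp: d_def)
      ultimately show False
        by linarith
    next
      \<comment> \<open>Each edge has an element that is at most \<open>n - a\<close>, so even the
        late minima fit into one block.\<close>
      assume n: "n \<le> a + (r - 1) * m"
      have "Min ` S \<subseteq> {c * d + 1..c * d + d}"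
      proof (rule image_subsetI)
        fix e assume "e \<in> S"
        then have "e \<in> ?E"
          using S(1) by blast
        then have e: "e \<subseteq> {1..n}" "\<not> e \<subseteq> {n - a + 1..n}" "finite e"
          by (simp add: subsets_not_within_def, simp add: subsets_not_within_def, rule Min(2))
        then obtain x where x: "x \<in> e" "x \<notin> {n - a + 1..n}"
          by blast
        then have "x \<le> n - a"
          using e(1) by auto
        then have "Min e \<le> n - a"
          using Min_le[OF e(3) x(1)] by linarith
        also have "n - a \<le> c * d + d"
          using n by (simp add: d_def \<open>m = Suc c\<close> mult.commute)
        finally show "Min e \<in> {c * d + 1..c * d + d}"
          using le[OF \<open>e \<in> S\<close>] by simp
      qed
      with not_block show False ..
    qed
  qed
  moreover have "col ` ?E \<subseteq> {..<m}"
    using assms(3) by (auto simp: col_def)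
  ultimately have "proper_coloring (KG r n k a) m col"
    by (simp add: proper_coloring_def KG_def kneser_def edges_hyp)
  then show ?thesis
    unfolding chromatic_number_def by (intro Least_le) blast
qed

text \<open>Reduces every comparison with a ceiling to an inequality between natural
  numbers.\<close>

lemma ceiling_quotient_le_iff:
  fixes n x r c :: nat
  assumes "2 \<le> r"
  shows "\<lceil>(real n - real x) / (real r - 1)\<rceil> \<le> int c \<longleftrightarrow> n \<le> x + (r - 1) * c"
proof -
  have "\<lceil>(real n - real x) / (real r - 1)\<rceil> \<le> int c \<longleftrightarrow> real n \<le> real x + (real r - 1) * real c"
    using assms by (simp add: ceiling_le_iff pos_divide_le_eq algebra_simps)
  also have "real x + (real r - 1) * real c = real (x + (r - 1) * c)"
    using assms by (simp add: of_nat_diff)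
  finally show ?thesis
    by (simp only: of_nat_le_iff)
qed

theorem proposition12:
  fixes n r k a :: nat
  assumes "0 < n" and "2 \<le> r" and "2 \<le> k" and "0 < a" and "a < n" and "r * k \<le> n"
  shows "(a \<le> 2 * (k - 1) \<or> r * k - 1 \<le> a \<longrightarrow>
           int (chromatic_number (KG r n k a)) =
             \<lceil>(real n - max (real r * (real k - 1)) (real a)) / (real r - 1)\<rceil>) \<and>
         (2 * k - 1 \<le> a \<and> a \<le> r * k - 2 \<longrightarrow>
           \<lceil>(real n - real r * (real k - 1) - real_of_int \<lfloor>real a / real k\<rfloor>) / (real r - 1)\<rceil>
             \<le> int (chromatic_number (KG r n k a)) \<and>
           int (chromatic_number (KG r n k a)) \<le>
             \<lceil>(real n - max (real r * (real k - 1)) (real a)) / (real r - 1)\<rceil>)"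
proof -
  let ?chi = "chromatic_number (KG r n k a)"
  let ?x = "max (r * (k - 1)) a"
  let ?ceil = "\<lceil>(real n - real ?x) / (real r - 1)\<rceil>"
  have real_x: "max (real r * (real k - 1)) (real a) = real ?x"
    using assms(3) by (simp add: of_nat_max of_nat_diff)
  have "r * (k - 1) < r * k"
    using assms(2,3) by simp
  \<comment> \<open>This makes the ceiling positive, as the colouring needs at least one
    colour.\<close>
  then have "?x < n"
    using assms(5,6) by linarith
  then have "0 < (real n - real ?x) / (real r - 1)"
    using assms(2) by simp
  then have "0 < ?ceil"
    by simp
  then obtain m where m: "?ceil = int m" "0 < m"
    by (metis of_nat_0_less_iff zero_less_imp_eq_int)
  then have "n \<le> ?x + (r - 1) * m"
    by (intro iffD1[OF ceiling_quotient_le_iff[OF assms(2)]]) simp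
  then have "n \<le> r * (k - 1) + (r - 1) * m \<or> n \<le> a + (r - 1) * m"
    by (simp add: max_def split: if_splits)
  then have "?chi \<le> m"
    using assms(2,3) m(2) by (intro chromatic_number_KG_upper) auto
  then have upper: "int ?chi \<le> ?ceil"
    using m(1) by simp
  have lower: "?ceil \<le> int ?chi" if "a \<le> 2 * (k - 1) \<or> r * k - 1 \<le> a"
    using that
  proof
    assume a: "a \<le> 2 * (k - 1)"
    have "n \<le> ?x + (r - 1) * ?chi"
      using chromatic_number_KG_lower[OF assms(2,3,5) a] by linarith
    then show ?thesis
      unfolding ceiling_quotient_le_iff[OF assms(2)] .
  next
    assume a: "r * k - 1 \<le> a"
    have "n \<le> ?x + (r - 1) * ?chi"
      using chromatic_number_KG_lower_large[OF assms(2,3,5) a] by linarith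
    then show ?thesis
      unfolding ceiling_quotient_le_iff[OF assms(2)] .
  qed
  have middle: "\<lceil>(real n - real r * (real k - 1) - real_of_int \<lfloor>real a / real k\<rfloor>) / (real r - 1)\<rceil>
      \<le> int ?chi" if "2 * k - 1 \<le> a \<and> a \<le> r * k - 2"
  proof -
    have "real r * (real k - 1) + real_of_int \<lfloor>real a / real k\<rfloor> = real (r * (k - 1) + a div k)"
      using assms(3) by (simp add: floor_divide_of_nat_eq of_nat_diff)
    then have eq: "real n - real r * (real k - 1) - real_of_int \<lfloor>real a / real k\<rfloor> =
        real n - real (r * (k - 1) + a div k)"
      by linarith
    have "a < r * k"
      using that assms(3) by linarith
    then show ?thesis
      unfolding eq ceiling_quotient_le_iff[OF assms(2)]
      by (rule chromatic_number_KG_lower_middle[OF assms(2,3,5)])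
  qed
  show ?thesis
    unfolding real_x using upper lower middle by (auto intro: antisym)
qed

end
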